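(* Let $D$ be a division ring of degree $p$ over its center $F=Z(D)$, i.e. $[D:F]=N$ with $N=p^2$, and let $a_1,\dots,a_{N-1}\in D$ be invertible elements such that $D=F+a_1F+\dots+a_{N-1}F$. Let $h: D_G[z]\rightarrow D\langle x_1,\dots,x_N\rangle$ be the ring homomorphism determined by $h(d)=d$ for all $d\in D$ and $h(z)=x_1+a_1x_2+\dots+a_{N-1}x_N$. Then $h$ is an isomorphism, and therefore $D_G[z]\cong D\langle x_1,\dots,x_N\rangle$.
   Context: $D_G[z]$ (the ring of general polynomials over $D$) is the associative ring of polynomials over $D$ in one variable $z$, where $z$ is assumed to commute with every element of the center $F=Z(D)$ but not with arbitrary elements of $D$; equivalently, it is the free product (coproduct) $D *_F F[z]$ of $F$-algebras. For example, for non-central $d\in D$ the elements $dz^2$, $zdz$, $z^2d$ are distinct. $D\langle x_1,\dots,x_N\rangle$ is the ring of polynomials over $D$ in $N$ variables, where each $x_i$ commutes with every $d\in D$ but $x_i$ is not assumed to commute with $x_j$ for $i\neq j$; that is, it is the monoid algebra over $D$ of the free monoid on $x_1,\dots,x_N$. *)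

theory Defs
  imports "HOL-Algebra.Embedded_Algebras" "HOL-Algebra.QuotRing" "HOL-Algebra.IntRing"
begin

text \<open>HOL-Algebra's locale \<^locale>\<open>field\<close> is commutative; this is the not necessarily
  commutative version.\<close>

locale skew_field = ring +
  assumes one_not_zero: "\<one> \<noteq> \<zero>"
    and Units_eq: "Units R = carrier R - {\<zero>}"

definition ring_center :: "('a, 'm) ring_scheme \<Rightarrow> 'a set" where
  "ring_center R = {c \<in> carrier R. \<forall>r \<in> carrier R. c \<otimes>\<^bsub>R\<^esub> r = r \<otimes>\<^bsub>R\<^esub> c}"

text \<open>The monoid algebra over \<open>R\<close> of the free monoid on \<open>V\<close>, for a not necessarily commutative
  ring \<open>R\<close>: an element is a finitely supported family of coefficients \<open>f w \<in> carrier R\<close> indexed by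
  the words \<open>w\<close> over \<open>V\<close>, extended by \<open>\<zero>\<close> to the remaining lists. Coefficients commute with the
  variables, but the variables do not commute with each other. In the product, the summation index
  runs over the ways to split a word into a prefix and a suffix.\<close>

definition free_algebra :: "('a, 'm) ring_scheme \<Rightarrow> 'x set \<Rightarrow> ('x list \<Rightarrow> 'a) ring" where
  "free_algebra R V =
    \<lparr>carrier = {f. (\<forall>w. f w \<in> carrier R) \<and> finite {w. f w \<noteq> \<zero>\<^bsub>R\<^esub>}
                   \<and> (\<forall>w. w \<notin> lists V \<longrightarrow> f w = \<zero>\<^bsub>R\<^esub>)},
     monoid.mult = (\<lambda>f g w. \<Oplus>\<^bsub>R\<^esub>i\<in>{..length w}. f (take i w) \<otimes>\<^bsub>R\<^esub> g (drop i w)),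
     one = (\<lambda>w. if w = [] then \<one>\<^bsub>R\<^esub> else \<zero>\<^bsub>R\<^esub>),
     zero = (\<lambda>w. \<zero>\<^bsub>R\<^esub>),
     add = (\<lambda>f g w. f w \<oplus>\<^bsub>R\<^esub> g w)\<rparr>"

definition fa_const :: "('a, 'm) ring_scheme \<Rightarrow> 'a \<Rightarrow> 'x list \<Rightarrow> 'a" where
  "fa_const R r = (\<lambda>w. if w = [] then r else \<zero>\<^bsub>R\<^esub>)"

definition fa_var :: "('a, 'm) ring_scheme \<Rightarrow> 'x \<Rightarrow> 'x list \<Rightarrow> 'a" where
  "fa_var R x = (\<lambda>w. if w = [x] then \<one>\<^bsub>R\<^esub> else \<zero>\<^bsub>R\<^esub>)"

abbreviation nc_poly :: "('a, 'm) ring_scheme \<Rightarrow> nat \<Rightarrow> (nat list \<Rightarrow> 'a) ring" where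
  "nc_poly D N \<equiv> free_algebra D {1..N}"

text \<open>The ring of general polynomials over \<open>D\<close> is given by generators and relations: it is
  generated by the elements of \<open>D\<close> and \<open>z\<close>, subject to the relations which hold in \<open>D\<close> and to
  \<open>z\<close> commuting with every element of the center. Thus a homomorphism out of it is the same as a
  ring homomorphism on \<open>D\<close> together with an element that commutes with the image of the center,
  which is the universal property of the coproduct of \<open>D\<close> and \<open>F[z]\<close> over the center \<open>F\<close>.\<close>

datatype 'a gen = Coeff 'a | Z

definition gp_free :: "('a, 'm) ring_scheme \<Rightarrow> ('a gen list \<Rightarrow> int) ring" where
  "gp_free D = free_algebra \<Z> (insert Z (Coeff ` carrier D))"

definition gp_relations :: "('a, 'm) ring_scheme \<Rightarrow> ('a gen list \<Rightarrow> int) set" where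
  "gp_relations D =
     (let c = (\<lambda>d. fa_var \<Z> (Coeff d)); z = fa_var \<Z> Z in
       {c (d \<oplus>\<^bsub>D\<^esub> e) \<ominus>\<^bsub>gp_free D\<^esub> (c d \<oplus>\<^bsub>gp_free D\<^esub> c e) | d e. d \<in> carrier D \<and> e \<in> carrier D}
     \<union> {c (d \<otimes>\<^bsub>D\<^esub> e) \<ominus>\<^bsub>gp_free D\<^esub> (c d \<otimes>\<^bsub>gp_free D\<^esub> c e) | d e. d \<in> carrier D \<and> e \<in> carrier D}
     \<union> {c \<one>\<^bsub>D\<^esub> \<ominus>\<^bsub>gp_free D\<^esub> \<one>\<^bsub>gp_free D\<^esub>}
     \<union> {(c d \<otimes>\<^bsub>gp_free D\<^esub> z) \<ominus>\<^bsub>gp_free D\<^esub> (z \<otimes>\<^bsub>gp_free D\<^esub> c d) | d. d \<in> ring_center D})"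

definition gp_ideal :: "('a, 'm) ring_scheme \<Rightarrow> ('a gen list \<Rightarrow> int) set" where
  "gp_ideal D = Idl\<^bsub>gp_free D\<^esub> gp_relations D"

definition general_poly :: "('a, 'm) ring_scheme \<Rightarrow> ('a gen list \<Rightarrow> int) set ring" where
  "general_poly D = gp_free D Quot gp_ideal D"

definition gp_const :: "('a, 'm) ring_scheme \<Rightarrow> 'a \<Rightarrow> ('a gen list \<Rightarrow> int) set" where
  "gp_const D d = gp_ideal D +>\<^bsub>gp_free D\<^esub> fa_var \<Z> (Coeff d)"

definition gp_z :: "('a, 'm) ring_scheme \<Rightarrow> ('a gen list \<Rightarrow> int) set" where
  "gp_z D = gp_ideal D +>\<^bsub>gp_free D\<^esub> fa_var \<Z> Z"

text \<open>The condition on \<open>h\<close> which determines the substitution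
  \<open>z \<mapsto> x\<^sub>1 + a\<^sub>1 x\<^sub>2 + \<dots> + a\<^sub>N\<^sub>-\<^sub>1 x\<^sub>N\<close> over \<open>D\<close>.\<close>

definition is_substitution ::
  "('a, 'm) ring_scheme \<Rightarrow> nat \<Rightarrow> (nat \<Rightarrow> 'a) \<Rightarrow> (('a gen list \<Rightarrow> int) set \<Rightarrow> nat list \<Rightarrow> 'a) \<Rightarrow> bool"
  where
  "is_substitution D N a h \<longleftrightarrow>
     h \<in> ring_hom (general_poly D) (nc_poly D N) \<and>
     (\<forall>d \<in> carrier D. h (gp_const D d) = fa_const D d) \<and>
     h (gp_z D) = fa_var D 1 \<oplus>\<^bsub>nc_poly D N\<^esub>
       (\<Oplus>\<^bsub>nc_poly D N\<^esub>i\<in>{1..N - 1}. fa_const D (a i) \<otimes>\<^bsub>nc_poly D N\<^esub> fa_var D (i + 1))"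

context ring begin

lemma fa_mult_Nil:
  assumes "\<And>w. f w \<in> carrier R" "\<And>w. g w \<in> carrier R"
  shows "(f \<otimes>\<^bsub>free_algebra R V\<^esub> g) [] = f [] \<otimes> g []"
  using assms by (simp add: free_algebra_def)

lemma fa_mult_Cons:
  assumes f: "\<And>w. f w \<in> carrier R" and g: "\<And>w. g w \<in> carrier R"
  shows "(f \<otimes>\<^bsub>free_algebra R V\<^esub> g) (x # w) =
    f [] \<otimes> g (x # w) \<oplus> ((\<lambda>w. f (x # w)) \<otimes>\<^bsub>free_algebra R V\<^esub> g) w"
proof -
  have "{..length (x # w)} = insert 0 (Suc ` {..length w})"
    by (simp add: atMost_Suc_eq_insert_0)
  then have "(f \<otimes>\<^bsub>free_algebra R V\<^esub> g) (x # w) =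
     (\<Oplus>i\<in>insert 0 (Suc ` {..length w}). f (take i (x # w)) \<otimes> g (drop i (x # w)))"
    by (simp add: free_algebra_def)
  also have "\<dots> = f [] \<otimes> g (x # w) \<oplus>
      (\<Oplus>i\<in>Suc ` {..length w}. f (take i (x # w)) \<otimes> g (drop i (x # w)))"
    using f g by (subst finsum_insert) auto
  also have "(\<Oplus>i\<in>Suc ` {..length w}. f (take i (x # w)) \<otimes> g (drop i (x # w))) =
      (\<Oplus>i\<in>{..length w}. f (x # take i w) \<otimes> g (drop i w))"
    using f g by (subst finsum_reindex) auto
  finally show ?thesis by (simp add: free_algebra_def)
qed

lemma fa_mult_closed:
  assumes f: "\<And>w. f w \<in> carrier R" and g: "\<And>w. g w \<in> carrier R"
  shows "(f \<otimes>\<^bsub>free_algebra R V\<^esub> g) w \<in> carrier R"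
  using f g by (simp add: free_algebra_def)

lemma fa_l_distr:
  assumes f: "\<And>w. f w \<in> carrier R" and f': "\<And>w. f' w \<in> carrier R"
    and g: "\<And>w. g w \<in> carrier R"
  shows "((\<lambda>w. f w \<oplus> f' w) \<otimes>\<^bsub>free_algebra R V\<^esub> g) w =
    (f \<otimes>\<^bsub>free_algebra R V\<^esub> g) w \<oplus> (f' \<otimes>\<^bsub>free_algebra R V\<^esub> g) w"
  using assms by (simp add: free_algebra_def l_distr finsum_addf)

lemma fa_r_distr:
  assumes f: "\<And>w. f w \<in> carrier R" and f': "\<And>w. f' w \<in> carrier R"
    and g: "\<And>w. g w \<in> carrier R"
  shows "(g \<otimes>\<^bsub>free_algebra R V\<^esub> (\<lambda>w. f w \<oplus> f' w)) w =
    (g \<otimes>\<^bsub>free_algebra R V\<^esub> f) w \<oplus> (g \<otimes>\<^bsub>free_algebra R V\<^esub> f') w"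
  using assms by (simp add: free_algebra_def r_distr finsum_addf)

lemma fa_smult_mult:
  assumes r: "r \<in> carrier R" and f: "\<And>w. f w \<in> carrier R" and g: "\<And>w. g w \<in> carrier R"
  shows "((\<lambda>w. r \<otimes> f w) \<otimes>\<^bsub>free_algebra R V\<^esub> g) w = r \<otimes> (f \<otimes>\<^bsub>free_algebra R V\<^esub> g) w"
  using assms by (simp add: free_algebra_def m_assoc finsum_rdistr Pi_def)

lemma fa_assoc:
  assumes g: "\<And>w. g w \<in> carrier R" and h: "\<And>w. h w \<in> carrier R"
  shows "(\<And>w. f w \<in> carrier R) \<Longrightarrow>
    ((f \<otimes>\<^bsub>free_algebra R V\<^esub> g) \<otimes>\<^bsub>free_algebra R V\<^esub> h) w =
    (f \<otimes>\<^bsub>free_algebra R V\<^esub> (g \<otimes>\<^bsub>free_algebra R V\<^esub> h)) w"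
proof (induction w arbitrary: f)
  case Nil
  then show ?case by (simp add: fa_mult_Nil fa_mult_closed g h m_assoc)
next
  case (Cons x w)
  note f = Cons.prems
  let ?A = "free_algebra R V"
  let ?f = "\<lambda>w. f (x # w)" and ?g = "\<lambda>w. g (x # w)"
  have 1: "(\<lambda>w. (f \<otimes>\<^bsub>?A\<^esub> g) (x # w)) = (\<lambda>w. f [] \<otimes> ?g w \<oplus> (?f \<otimes>\<^bsub>?A\<^esub> g) w)"
    by (rule ext) (rule fa_mult_Cons[OF f g])
  have "((f \<otimes>\<^bsub>?A\<^esub> g) \<otimes>\<^bsub>?A\<^esub> h) (x # w) =
     (f [] \<otimes> g []) \<otimes> h (x # w) \<oplus>
     (f [] \<otimes> (?g \<otimes>\<^bsub>?A\<^esub> h) w \<oplus> ((?f \<otimes>\<^bsub>?A\<^esub> g) \<otimes>\<^bsub>?A\<^esub> h) w)"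
    by (subst fa_mult_Cons)
       (simp_all add: 1 f g h fa_mult_closed fa_mult_Nil fa_l_distr fa_smult_mult)
  also have "\<dots> = (f [] \<otimes> g []) \<otimes> h (x # w) \<oplus>
     (f [] \<otimes> (?g \<otimes>\<^bsub>?A\<^esub> h) w \<oplus> (?f \<otimes>\<^bsub>?A\<^esub> (g \<otimes>\<^bsub>?A\<^esub> h)) w)"
    using Cons.IH[of ?f] f by simp
  also have "\<dots> = f [] \<otimes> (g \<otimes>\<^bsub>?A\<^esub> h) (x # w) \<oplus> (?f \<otimes>\<^bsub>?A\<^esub> (g \<otimes>\<^bsub>?A\<^esub> h)) w"
    by (simp add: fa_mult_Cons f g h fa_mult_closed r_distr m_assoc a_assoc)
  also have "\<dots> = (f \<otimes>\<^bsub>?A\<^esub> (g \<otimes>\<^bsub>?A\<^esub> h)) (x # w)"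
    by (subst fa_mult_Cons) (simp_all add: f g h fa_mult_closed)
  finally show ?case .
qed

lemma fa_mult_carrier:
  assumes f: "f \<in> carrier (free_algebra R V)" and g: "g \<in> carrier (free_algebra R V)"
  shows "f \<otimes>\<^bsub>free_algebra R V\<^esub> g \<in> carrier (free_algebra R V)"
proof -
  let ?A = "free_algebra R V"
  let ?S = "{w. f w \<noteq> \<zero>}" and ?T = "{w. g w \<noteq> \<zero>}"
  have fc: "f w \<in> carrier R" and gc: "g w \<in> carrier R" for w
    using f g by (auto simp: free_algebra_def)
  have fin: "finite ?S" "finite ?T" and sub: "?S \<subseteq> lists V" "?T \<subseteq> lists V"
    using f g by (auto simp: free_algebra_def)
  have zero: "(f \<otimes>\<^bsub>?A\<^esub> g) w = \<zero>" if w: "w \<notin> (\<lambda>(u, v). u @ v) ` (?S \<times> ?T)" for w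
  proof -
    have "f (take i w) \<otimes> g (drop i w) = \<zero>" for i
    proof (rule ccontr)
      assume "\<not> ?thesis"
      then have "f (take i w) \<noteq> \<zero>" "g (drop i w) \<noteq> \<zero>"
        using fc gc by auto
      then have "w \<in> (\<lambda>(u, v). u @ v) ` (?S \<times> ?T)"
        by (intro image_eqI[where x = "(take i w, drop i w)"]) auto
      with w show False by simp
    qed
    then show ?thesis by (simp add: free_algebra_def)
  qed
  have "{w. (f \<otimes>\<^bsub>?A\<^esub> g) w \<noteq> \<zero>} \<subseteq> (\<lambda>(u, v). u @ v) ` (?S \<times> ?T)"
    using zero by blast
  then have "finite {w. (f \<otimes>\<^bsub>?A\<^esub> g) w \<noteq> \<zero>}"
    using fin by (meson finite_SigmaI finite_imageI finite_subset)
  moreover have "(f \<otimes>\<^bsub>?A\<^esub> g) w = \<zero>" if "w \<notin> lists V" for w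
    using that sub by (intro zero) (auto 4 4 simp: subset_iff)
  moreover have "(f \<otimes>\<^bsub>?A\<^esub> g) w \<in> carrier R" for w
    using fa_mult_closed fc gc by blast
  ultimately show ?thesis by (simp add: free_algebra_def)
qed

lemma free_algebra_is_ring: "ring (free_algebra R V)"
proof (rule ringI)
  let ?A = "free_algebra R V"
  have carr: "f w \<in> carrier R" if "f \<in> carrier ?A" for f w
    using that by (simp add: free_algebra_def)
  have one: "\<one>\<^bsub>?A\<^esub> \<in> carrier ?A"
    by (auto simp: free_algebra_def)
  have l_one: "\<one>\<^bsub>?A\<^esub> \<otimes>\<^bsub>?A\<^esub> f = f" if f: "f \<in> carrier ?A" for f
  proof
    fix w
    have 0: "((\<lambda>w. \<zero>) \<otimes>\<^bsub>?A\<^esub> f) w = \<zero>" for w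
      using carr[OF f] by (simp add: free_algebra_def)
    have [simp]: "\<one>\<^bsub>?A\<^esub> = (\<lambda>w. if w = [] then \<one> else \<zero>)"
      by (simp add: free_algebra_def)
    show "(\<one>\<^bsub>?A\<^esub> \<otimes>\<^bsub>?A\<^esub> f) w = f w"
      by (cases w) (simp_all add: fa_mult_Nil fa_mult_Cons carr[OF f] 0)
  qed
  have r_one: "f \<otimes>\<^bsub>?A\<^esub> \<one>\<^bsub>?A\<^esub> = f" if f: "f \<in> carrier ?A" for f
  proof
    fix w
    have [simp]: "\<one>\<^bsub>?A\<^esub> = (\<lambda>w. if w = [] then \<one> else \<zero>)"
      by (simp add: free_algebra_def)
    have "(\<And>w. f w \<in> carrier R) \<Longrightarrow> (f \<otimes>\<^bsub>?A\<^esub> \<one>\<^bsub>?A\<^esub>) w = f w" for f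
      by (induction w arbitrary: f) (simp_all add: fa_mult_Nil fa_mult_Cons)
    with carr[OF f] show "(f \<otimes>\<^bsub>?A\<^esub> \<one>\<^bsub>?A\<^esub>) w = f w" by blast
  qed
  have add: "f \<oplus>\<^bsub>?A\<^esub> g = (\<lambda>w. f w \<oplus> g w)" for f g
    by (simp add: free_algebra_def)
  have add_closed: "f \<oplus>\<^bsub>?A\<^esub> g \<in> carrier ?A" if "f \<in> carrier ?A" "g \<in> carrier ?A" for f g
  proof -
    have "{w. f w \<oplus> g w \<noteq> \<zero>} \<subseteq> {w. f w \<noteq> \<zero>} \<union> {w. g w \<noteq> \<zero>}" by auto
    with that show ?thesis
      by (auto simp: free_algebra_def intro: finite_subset)
  qed
  show "abelian_group ?A"
  proof (rule abelian_groupI)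
    fix f assume f: "f \<in> carrier ?A"
    have "{w. \<ominus> f w \<noteq> \<zero>} = {w. f w \<noteq> \<zero>}" using carr[OF f] by auto
    then have "(\<lambda>w. \<ominus> f w) \<in> carrier ?A"
      using f by (simp add: free_algebra_def)
    moreover have "(\<lambda>w. \<ominus> f w) \<oplus>\<^bsub>?A\<^esub> f = \<zero>\<^bsub>?A\<^esub>"
      using carr[OF f] by (simp add: free_algebra_def l_neg)
    ultimately show "\<exists>g\<in>carrier ?A. g \<oplus>\<^bsub>?A\<^esub> f = \<zero>\<^bsub>?A\<^esub>" by blast
  qed (auto simp: add_closed, auto simp: free_algebra_def a_ac)
  show "Group.monoid ?A"
    by (rule Group.monoidI)
       (auto simp: one l_one r_one fa_mult_carrier intro!: ext fa_assoc dest: carr)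
  show "(f \<oplus>\<^bsub>?A\<^esub> g) \<otimes>\<^bsub>?A\<^esub> h = f \<otimes>\<^bsub>?A\<^esub> h \<oplus>\<^bsub>?A\<^esub> g \<otimes>\<^bsub>?A\<^esub> h"
    if "f \<in> carrier ?A" "g \<in> carrier ?A" "h \<in> carrier ?A" for f g h
    using that by (auto simp: add carr fa_l_distr)
  show "h \<otimes>\<^bsub>?A\<^esub> (f \<oplus>\<^bsub>?A\<^esub> g) = h \<otimes>\<^bsub>?A\<^esub> f \<oplus>\<^bsub>?A\<^esub> h \<otimes>\<^bsub>?A\<^esub> g"
    if "f \<in> carrier ?A" "g \<in> carrier ?A" "h \<in> carrier ?A" for f g h
    using that by (auto simp: add carr fa_r_distr)
qed

end

lemma gp_free_is_ring: "ring (gp_free D)"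
  unfolding gp_free_def by (rule ring.free_algebra_is_ring) (rule cring.axioms(1)[OF int_is_cring])

lemma fa_var_gp_free:
  "fa_var \<Z> Z \<in> carrier (gp_free D)"
  "d \<in> carrier D \<Longrightarrow> fa_var \<Z> (Coeff d) \<in> carrier (gp_free D)"
  by (auto simp: gp_free_def free_algebra_def fa_var_def)

lemma gp_relations_closed:
  assumes "ring D" shows "gp_relations D \<subseteq> carrier (gp_free D)"
proof -
  interpret D: ring D by fact
  interpret P: ring "gp_free D" by (rule gp_free_is_ring)
  show ?thesis
    by (auto simp: gp_relations_def Let_def ring_center_def fa_var_gp_free)
qed

lemma gp_ideal_is_ideal: "ring D \<Longrightarrow> ideal (gp_ideal D) (gp_free D)"
  unfolding gp_ideal_def
  by (rule ring.genideal_ideal[OF gp_free_is_ring gp_relations_closed])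

lemma general_poly_is_ring: "ring D \<Longrightarrow> ring (general_poly D)"
  unfolding general_poly_def by (rule ideal.quotient_is_ring[OF gp_ideal_is_ideal])

lemma gp_coset_eq:
  assumes D: "ring D" and "x \<in> carrier (gp_free D)" "y \<in> carrier (gp_free D)"
    and "x \<ominus>\<^bsub>gp_free D\<^esub> y \<in> gp_relations D"
  shows "gp_ideal D +>\<^bsub>gp_free D\<^esub> x = gp_ideal D +>\<^bsub>gp_free D\<^esub> y"
proof -
  interpret P: ring "gp_free D" by (rule gp_free_is_ring)
  interpret I: ideal "gp_ideal D" "gp_free D" by (rule gp_ideal_is_ideal[OF D])
  have "x \<ominus>\<^bsub>gp_free D\<^esub> y \<in> gp_ideal D"
    unfolding gp_ideal_def
    using ring.genideal_self[OF gp_free_is_ring gp_relations_closed[OF D]] assms(4) by blast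
  then show ?thesis
    using P.quotient_eq_iff_same_a_r_cos[OF I.ideal_axioms, of x y] assms by simp
qed

lemma gp_const_hom:
  assumes D: "ring D" shows "gp_const D \<in> ring_hom D (general_poly D)"
proof -
  interpret D: ring D by fact
  interpret P: ring "gp_free D" by (rule gp_free_is_ring)
  interpret I: ideal "gp_ideal D" "gp_free D" by (rule gp_ideal_is_ideal[OF D])
  let ?c = "\<lambda>d. fa_var \<Z> (Coeff d)"
  let ?q = "(+>\<^bsub>gp_free D\<^esub>) (gp_ideal D)"
  have q: "?q \<in> ring_hom (gp_free D) (general_poly D)"
    unfolding general_poly_def by (rule I.rcos_ring_hom)
  note c = fa_var_gp_free(2)
  show ?thesis
  proof (rule ring_hom_memI)
    fix d assume d: "d \<in> carrier D"
    show "gp_const D d \<in> carrier (general_poly D)"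
      unfolding gp_const_def by (rule ring_hom_closed[OF q c[OF d]])
    fix e assume e: "e \<in> carrier D"
    have "?q (?c (d \<otimes>\<^bsub>D\<^esub> e)) = ?q (?c d \<otimes>\<^bsub>gp_free D\<^esub> ?c e)"
      using d e by (intro gp_coset_eq[OF D]) (auto simp: c, auto simp: gp_relations_def Let_def)
    then show "gp_const D (d \<otimes>\<^bsub>D\<^esub> e) = gp_const D d \<otimes>\<^bsub>general_poly D\<^esub> gp_const D e"
      using ring_hom_mult[OF q c[OF d] c[OF e]] by (simp add: gp_const_def)
    have "?q (?c (d \<oplus>\<^bsub>D\<^esub> e)) = ?q (?c d \<oplus>\<^bsub>gp_free D\<^esub> ?c e)"
      using d e by (intro gp_coset_eq[OF D]) (auto simp: c, auto simp: gp_relations_def Let_def)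
    then show "gp_const D (d \<oplus>\<^bsub>D\<^esub> e) = gp_const D d \<oplus>\<^bsub>general_poly D\<^esub> gp_const D e"
      using ring_hom_add[OF q c[OF d] c[OF e]] by (simp add: gp_const_def)
  next
    have "?q (?c \<one>\<^bsub>D\<^esub>) = ?q \<one>\<^bsub>gp_free D\<^esub>"
      by (intro gp_coset_eq[OF D]) (auto simp: c, auto simp: gp_relations_def Let_def)
    then show "gp_const D \<one>\<^bsub>D\<^esub> = \<one>\<^bsub>general_poly D\<^esub>"
      using ring_hom_one[OF q] by (simp add: gp_const_def)
  qed
qed

lemma gp_z_closed: "ring D \<Longrightarrow> gp_z D \<in> carrier (general_poly D)"
  unfolding gp_z_def general_poly_def
  by (rule ring_hom_closed[OF ideal.rcos_ring_hom[OF gp_ideal_is_ideal] fa_var_gp_free(1)])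

lemma gp_z_center:
  assumes D: "ring D" and d: "d \<in> ring_center D"
  shows "gp_const D d \<otimes>\<^bsub>general_poly D\<^esub> gp_z D = gp_z D \<otimes>\<^bsub>general_poly D\<^esub> gp_const D d"
proof -
  interpret P: ring "gp_free D" by (rule gp_free_is_ring)
  interpret I: ideal "gp_ideal D" "gp_free D" by (rule gp_ideal_is_ideal[OF D])
  let ?c = "fa_var \<Z> (Coeff d)" and ?z = "fa_var \<Z> Z"
  let ?q = "(+>\<^bsub>gp_free D\<^esub>) (gp_ideal D)"
  have q: "?q \<in> ring_hom (gp_free D) (general_poly D)"
    unfolding general_poly_def by (rule I.rcos_ring_hom)
  have c: "?c \<in> carrier (gp_free D)" and z: "?z \<in> carrier (gp_free D)"
    using d by (auto simp: ring_center_def intro: fa_var_gp_free)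
  have "?q (?c \<otimes>\<^bsub>gp_free D\<^esub> ?z) = ?q (?z \<otimes>\<^bsub>gp_free D\<^esub> ?c)"
    using d by (intro gp_coset_eq[OF D]) (auto simp: c z, auto simp: gp_relations_def Let_def)
  then show ?thesis
    using ring_hom_mult[OF q c z] ring_hom_mult[OF q z c] by (simp add: gp_const_def gp_z_def)
qed

end

theory Submission
  imports Defs "HOL-Algebra.UnivPoly"
begin

text \<open>Let \<open>b\<^sub>0 = 1, b\<^sub>1 = a\<^sub>1, \<dots>\<close> be the given basis of \<open>D\<close> over \<open>F\<close>. By the density theorem for the
  bimodule \<open>D\<close>, the coordinate functionals of this basis have the form
  \<open>d \<mapsto> \<Sum>\<^sub>l u\<^sub>k\<^sub>l d b\<^sub>l\<close>. The elements \<open>y\<^sub>k = \<Sum>\<^sub>l u\<^sub>k\<^sub>l z b\<^sub>l\<close> of \<open>D\<^sub>G[z]\<close> then commute with \<open>D\<close> and satisfy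
  \<open>z = \<Sum>\<^sub>k b\<^sub>k y\<^sub>k\<close>: such identities hold as soon as they hold for the operators on \<open>D\<close>, because the
  operator \<open>d \<mapsto> \<Sum>\<^sub>l u\<^sub>l d b\<^sub>l\<close> determines its coefficients \<open>u\<^sub>l\<close>. Hence sending the \<open>k\<close>-th variable to
  \<open>y\<^sub>k\<close> defines a homomorphism on the free algebra, and it is inverse to \<open>h\<close>.\<close>

section \<open>The universal property of the free algebra\<close>

text \<open>General polynomials are given by generators and relations, so there is no normal form in
  which an identity could be compared coefficient by coefficient. Identities that are linear in
  \<open>z\<close> are therefore reduced to \<open>D\<close>. With the right-hand factors fixed to
  be the basis, such an expression is encoded by its tuple of left coefficients in \<open>D\<close>.
  Multiplication by constants on either side acts on tuples by formulas that mention only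
  \<open>D\<close> and its center and that hold for every \<open>z\<close> commuting with the
  center. On elements of \<open>D\<close> the tuples become operators, and this action is faithful.
  So an equality of tuples is checked on \<open>D\<close>, where coordinates make it evident, and is
  then read at \<open>gp_z D\<close>. The tuples take the place of the tensor product of
  \<open>D\<close> with itself over \<open>F\<close>.

  The family formed by the unit and the \<open>a i\<close> is only assumed to span. Its independence
  comes from counting: \<open>N\<close> spanning elements of an \<open>N\<close>-dimensional space
  admit no dependency.\<close>

context ring begin

lemma fa_carrierD:
  assumes "f \<in> carrier (free_algebra R V)"
  shows "f w \<in> carrier R" "finite {w. f w \<noteq> \<zero>}" "{w. f w \<noteq> \<zero>} \<subseteq> lists V"
  using assms by (auto simp: free_algebra_def)

lemma fa_const_closed: "r \<in> carrier R \<Longrightarrow> fa_const R r \<in> carrier (free_algebra R V)"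
  by (auto simp: free_algebra_def fa_const_def)

lemma fa_var_closed: "x \<in> V \<Longrightarrow> fa_var R x \<in> carrier (free_algebra R V)"
  by (auto simp: free_algebra_def fa_var_def)

lemma fa_const_in: "r \<in> carrier R \<Longrightarrow> fa_const R r w \<in> carrier R"
  by (simp add: fa_const_def)

lemma fa_var_in: "fa_var R x w \<in> carrier R"
  by (simp add: fa_var_def)

lemma fa_const_mult:
  assumes "r \<in> carrier R" and f: "f \<in> carrier (free_algebra R V)"
  shows "fa_const R r \<otimes>\<^bsub>free_algebra R V\<^esub> f = (\<lambda>w. r \<otimes> f w)"
proof
  fix w
  have 0: "((\<lambda>w. \<zero>) \<otimes>\<^bsub>free_algebra R V\<^esub> f) w = \<zero>" for w
    using fa_carrierD(1)[OF f] by (simp add: free_algebra_def)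
  show "(fa_const R r \<otimes>\<^bsub>free_algebra R V\<^esub> f) w = r \<otimes> f w"
    using assms(1)
    by (cases w) (simp_all add: fa_mult_Nil fa_mult_Cons fa_carrierD[OF f] 0 fa_const_def)
qed

text \<open>Only pointwise closure of \<open>f\<close> is assumed, so that the induction can pass to
  the tail \<open>\<lambda>w. f (x # w)\<close> without carrying finite support along.\<close>

lemma fa_mult_const:
  assumes "r \<in> carrier R" and f: "\<And>w. f w \<in> carrier R"
  shows "(f \<otimes>\<^bsub>free_algebra R V\<^esub> fa_const R r) w = f w \<otimes> r"
  using f
proof (induction w arbitrary: f)
  case Nil
  then show ?case using assms(1) by (simp add: fa_mult_Nil fa_const_def)
next
  case (Cons x w)
  have "(f \<otimes>\<^bsub>free_algebra R V\<^esub> fa_const R r) (x # w) =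
      f [] \<otimes> fa_const R r (x # w) \<oplus> ((\<lambda>w. f (x # w)) \<otimes>\<^bsub>free_algebra R V\<^esub> fa_const R r) w"
    using Cons.prems assms(1) by (intro fa_mult_Cons fa_const_in)
  also have "\<dots> = f (x # w) \<otimes> r"
    using Cons.IH[of "\<lambda>w. f (x # w)"] Cons.prems assms(1) by (simp add: fa_const_def)
  finally show ?case .
qed

lemma fa_var_mult:
  assumes f: "f \<in> carrier (free_algebra R V)"
  shows "fa_var R x \<otimes>\<^bsub>free_algebra R V\<^esub> f =
    (\<lambda>w. case w of [] \<Rightarrow> \<zero> | y # v \<Rightarrow> if y = x then f v else \<zero>)"
proof
  fix w
  have 0: "((\<lambda>w. \<zero>) \<otimes>\<^bsub>free_algebra R V\<^esub> f) w = \<zero>" for w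
    using fa_carrierD(1)[OF f] by (simp add: free_algebra_def)
  \<comment> \<open>The tail of \<open>fa_var R x\<close> after the letter \<open>x\<close> is the
    indicator of the empty word, that is, the constant \<open>\<one>\<close>.\<close>
  have 1: "((\<lambda>w. if w = [] then \<one> else \<zero>) \<otimes>\<^bsub>free_algebra R V\<^esub> f) w = f w" for w
    using fa_const_mult[OF one_closed f] fa_carrierD[OF f] by (simp add: fa_const_def)
  show "(fa_var R x \<otimes>\<^bsub>free_algebra R V\<^esub> f) w =
      (case w of [] \<Rightarrow> \<zero> | y # v \<Rightarrow> if y = x then f v else \<zero>)"
    by (cases w) (simp_all add: fa_mult_Nil fa_mult_Cons fa_carrierD[OF f] 0 1 fa_var_def)
qed

lemma fa_const_hom: "fa_const R \<in> ring_hom R (free_algebra R V)"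
proof (rule ring_hom_memI)
  fix r s assume r: "r \<in> carrier R" and s: "s \<in> carrier R"
  show "fa_const R (r \<otimes> s) = fa_const R r \<otimes>\<^bsub>free_algebra R V\<^esub> fa_const R s"
    unfolding fa_const_mult[OF r fa_const_closed[OF s]] using r by (auto simp: fa_const_def)
qed (auto simp: fa_const_closed, auto simp: fa_const_def free_algebra_def)

lemma fa_const_var_commute:
  assumes r: "r \<in> carrier R" and x: "x \<in> V"
  shows "fa_const R r \<otimes>\<^bsub>free_algebra R V\<^esub> fa_var R x =
    fa_var R x \<otimes>\<^bsub>free_algebra R V\<^esub> fa_const R r"
proof
  fix w
  show "(fa_const R r \<otimes>\<^bsub>free_algebra R V\<^esub> fa_var R x) w =
      (fa_var R x \<otimes>\<^bsub>free_algebra R V\<^esub> fa_const R r) w"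
    using r
    by (simp add: fa_const_mult[OF r fa_var_closed[OF x]] fa_mult_const fa_var_in)
      (simp add: fa_var_def)
qed

text \<open>Every element is a finite sum of monomials, and a monomial arises from a constant by
  prefixing letters. The coefficient then sits at the right end, which loses nothing because
  coefficients commute with variables.\<close>

lemma free_algebra_induct [consumes 1, case_names const var add]:
  assumes f: "f \<in> carrier (free_algebra R V)"
    and const: "\<And>r. r \<in> carrier R \<Longrightarrow> P (fa_const R r)"
    and var: "\<And>x f. \<lbrakk>x \<in> V; f \<in> carrier (free_algebra R V); P f\<rbrakk> \<Longrightarrow>
      P (fa_var R x \<otimes>\<^bsub>free_algebra R V\<^esub> f)"
    and add: "\<And>f g. \<lbrakk>f \<in> carrier (free_algebra R V); g \<in> carrier (free_algebra R V); P f; P g\<rbrakk> \<Longrightarrow>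
      P (f \<oplus>\<^bsub>free_algebra R V\<^esub> g)"
  shows "P f"
proof -
  let ?A = "free_algebra R V"
  have mono_closed: "(\<lambda>v. if v = w then r else \<zero>) \<in> carrier ?A"
    if "r \<in> carrier R" "w \<in> lists V" for r w
    using that by (auto simp: free_algebra_def)
  have mono: "P (\<lambda>v. if v = w then r else \<zero>)" if r: "r \<in> carrier R" and "w \<in> lists V" for r w
    using that(2)
  proof (induction w)
    case Nil
    then show ?case using const[OF r] by (simp add: fa_const_def)
  next
    case (Cons x w)
    have "fa_var R x \<otimes>\<^bsub>?A\<^esub> (\<lambda>v. if v = w then r else \<zero>) = (\<lambda>v. if v = x # w then r else \<zero>)"
      by (subst fa_var_mult[OF mono_closed]) (use Cons r in \<open>auto split: list.splits\<close>)
    with var[OF _ mono_closed[OF r]] Cons show ?case by metis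
  qed
  \<comment> \<open>The induction runs over a finite superset \<open>S\<close> of the support, so a
    word with coefficient zero can simply be dropped; otherwise the monomial at \<open>w\<close> is
    split off.\<close>
  have "P f" if "finite S" "{w. f w \<noteq> \<zero>} \<subseteq> S" "f \<in> carrier ?A" for S f
    using that
  proof (induction S arbitrary: f)
    case empty
    then have "f = fa_const R \<zero>" by (auto simp: fa_const_def)
    then show ?case using const by simp
  next
    case (insert w S)
    show ?case
    proof (cases "f w = \<zero>")
      case True
      then show ?thesis using insert by (intro insert.IH) auto
    next
      case False
      let ?g = "f(w := \<zero>)" and ?m = "\<lambda>v. if v = w then f w else \<zero>"
      have w: "w \<in> lists V" using fa_carrierD(3)[OF insert.prems(2)] False by auto
      have fw: "f v \<in> carrier R" for v using fa_carrierD(1)[OF insert.prems(2)] .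
      have "{v. ?g v \<noteq> \<zero>} \<subseteq> {v. f v \<noteq> \<zero>}" by auto
      then have g: "?g \<in> carrier ?A"
        using insert.prems(2) by (auto simp: free_algebra_def intro: finite_subset)
      have "P ?g" using insert.prems by (intro insert.IH g) auto
      then have "P (?g \<oplus>\<^bsub>?A\<^esub> ?m)"
        by (intro add g mono_closed mono fw w)
      moreover have "?g \<oplus>\<^bsub>?A\<^esub> ?m = f" using fw by (auto simp: free_algebra_def)
      ultimately show ?thesis by simp
    qed
  qed
  from this[OF _ _ f] fa_carrierD[OF f] show ?thesis by blast
qed

end

lemma free_algebra_hom_unique:
  assumes "ring R" "ring S"
    and g: "g \<in> ring_hom (free_algebra R V) S" and h: "h \<in> ring_hom (free_algebra R V) S"
    and const: "\<And>r. r \<in> carrier R \<Longrightarrow> g (fa_const R r) = h (fa_const R r)"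
    and var: "\<And>x. x \<in> V \<Longrightarrow> g (fa_var R x) = h (fa_var R x)"
    and f: "f \<in> carrier (free_algebra R V)"
  shows "g f = h f"
proof -
  interpret ring R by fact
  show ?thesis
    using f
    by (induction rule: free_algebra_induct)
      (simp_all add: const var ring_hom_mult[OF g] ring_hom_mult[OF h] ring_hom_add[OF g]
        ring_hom_add[OF h] fa_var_closed)
qed

text \<open>Used twice: with integer coefficients, to evaluate the presentation behind
  \<open>general_poly\<close>, and with coefficients in \<open>D\<close>, to build the inverse of
  the substitution. The images of the variables need not commute with one another.\<close>

locale free_algebra_eval = ring_hom_ring R S \<sigma>
  for R (structure) and S (structure) and \<sigma> +
  fixes V :: "'x set" and \<phi> :: "'x \<Rightarrow> 'c"
  assumes var_closed: "x \<in> V \<Longrightarrow> \<phi> x \<in> carrier S"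
    and commute: "\<lbrakk>r \<in> carrier R; x \<in> V\<rbrakk> \<Longrightarrow> \<sigma> r \<otimes>\<^bsub>S\<^esub> \<phi> x = \<phi> x \<otimes>\<^bsub>S\<^esub> \<sigma> r"
begin

definition word :: "'x list \<Rightarrow> 'c" where
  "word w = foldr (\<lambda>x s. \<phi> x \<otimes>\<^bsub>S\<^esub> s) w \<one>\<^bsub>S\<^esub>"

definition eval_at :: "('x list \<Rightarrow> 'a) \<Rightarrow> 'c" where
  "eval_at f = (\<Oplus>\<^bsub>S\<^esub>w\<in>{w. f w \<noteq> \<zero>}. \<sigma> (f w) \<otimes>\<^bsub>S\<^esub> word w)"

lemma word_closed: "w \<in> lists V \<Longrightarrow> word w \<in> carrier S"
  by (induction w) (auto simp: word_def var_closed)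

text \<open>Cancellation may shrink the support of a sum, so \<open>eval_add\<close> compares its
  terms over a common finite set of words; the extra words contribute zero.\<close>

lemma eval_superset:
  assumes f: "f \<in> carrier (free_algebra R V)" and A: "finite A" "{w. f w \<noteq> \<zero>} \<subseteq> A" "A \<subseteq> lists V"
  shows "eval_at f = (\<Oplus>\<^bsub>S\<^esub>w\<in>A. \<sigma> (f w) \<otimes>\<^bsub>S\<^esub> word w)"
  unfolding eval_at_def using A R.fa_carrierD[OF f]
  by (intro S.add.finprod_mono_neutral_cong_left) (auto simp: word_closed subset_iff)

lemma eval_closed:
  assumes f: "f \<in> carrier (free_algebra R V)"
  shows "eval_at f \<in> carrier S"
  unfolding eval_at_def using R.fa_carrierD[OF f]
  by (intro S.finsum_closed) (auto intro!: S.m_closed word_closed)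

lemma eval_add:
  assumes f: "f \<in> carrier (free_algebra R V)" and g: "g \<in> carrier (free_algebra R V)"
  shows "eval_at (f \<oplus>\<^bsub>free_algebra R V\<^esub> g) = eval_at f \<oplus>\<^bsub>S\<^esub> eval_at g"
proof -
  interpret A: ring "free_algebra R V" by (rule R.free_algebra_is_ring)
  let ?W = "{w. f w \<noteq> \<zero>} \<union> {w. g w \<noteq> \<zero>}"
  note fD = R.fa_carrierD[OF f] and gD = R.fa_carrierD[OF g]
  have W: "finite ?W" "?W \<subseteq> lists V" using fD gD by auto
  have wc: "word w \<in> carrier S" if "f w \<noteq> \<zero> \<or> g w \<noteq> \<zero>" for w
    using that W(2) by (intro word_closed) auto
  have fg: "(f \<oplus>\<^bsub>free_algebra R V\<^esub> g) = (\<lambda>w. f w \<oplus> g w)" by (simp add: free_algebra_def)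
  have "eval_at (f \<oplus>\<^bsub>free_algebra R V\<^esub> g) = (\<Oplus>\<^bsub>S\<^esub>w\<in>?W. \<sigma> (f w \<oplus> g w) \<otimes>\<^bsub>S\<^esub> word w)"
    by (subst eval_superset[OF A.a_closed[OF f g] W(1) _ W(2)]) (auto simp: fg)
  also have "\<dots> = (\<Oplus>\<^bsub>S\<^esub>w\<in>?W. \<sigma> (f w) \<otimes>\<^bsub>S\<^esub> word w \<oplus>\<^bsub>S\<^esub> \<sigma> (g w) \<otimes>\<^bsub>S\<^esub> word w)"
    using wc fD gD by (intro S.finsum_cong') (auto simp: S.l_distr)
  also have "\<dots> = eval_at f \<oplus>\<^bsub>S\<^esub> eval_at g"
    using wc fD gD W
    by (subst eval_superset[OF f W(1) _ W(2)], simp, subst eval_superset[OF g W(1) _ W(2)], simp)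
      (subst S.finsum_addf, auto)
  finally show ?thesis .
qed

lemma eval_const_mult:
  assumes r: "r \<in> carrier R" and f: "f \<in> carrier (free_algebra R V)"
  shows "eval_at (fa_const R r \<otimes>\<^bsub>free_algebra R V\<^esub> f) = \<sigma> r \<otimes>\<^bsub>S\<^esub> eval_at f"
proof -
  interpret A: ring "free_algebra R V" by (rule R.free_algebra_is_ring)
  let ?W = "{w. f w \<noteq> \<zero>}"
  note fD = R.fa_carrierD[OF f]
  have wc: "word w \<in> carrier S" if "f w \<noteq> \<zero>" for w
    using that fD(3) by (intro word_closed) auto
  have "eval_at (fa_const R r \<otimes>\<^bsub>free_algebra R V\<^esub> f) = (\<Oplus>\<^bsub>S\<^esub>w\<in>?W. \<sigma> (r \<otimes> f w) \<otimes>\<^bsub>S\<^esub> word w)"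
    by (subst eval_superset[OF A.m_closed[OF R.fa_const_closed[OF r] f] fD(2) _ fD(3)])
      (use r in \<open>auto simp: R.fa_const_mult[OF r f]\<close>)
  also have "\<dots> = (\<Oplus>\<^bsub>S\<^esub>w\<in>?W. \<sigma> r \<otimes>\<^bsub>S\<^esub> (\<sigma> (f w) \<otimes>\<^bsub>S\<^esub> word w))"
    using wc fD r by (intro S.finsum_cong') (auto simp: S.m_assoc)
  also have "\<dots> = \<sigma> r \<otimes>\<^bsub>S\<^esub> eval_at f"
    unfolding eval_at_def using wc fD r by (subst S.finsum_rdistr) auto
  finally show ?thesis .
qed

lemma eval_var_mult:
  assumes x: "x \<in> V" and f: "f \<in> carrier (free_algebra R V)"
  shows "eval_at (fa_var R x \<otimes>\<^bsub>free_algebra R V\<^esub> f) = \<phi> x \<otimes>\<^bsub>S\<^esub> eval_at f"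
proof -
  interpret A: ring "free_algebra R V" by (rule R.free_algebra_is_ring)
  let ?W = "{w. f w \<noteq> \<zero>}" and ?g = "fa_var R x \<otimes>\<^bsub>free_algebra R V\<^esub> f"
  note fD = R.fa_carrierD[OF f]
  have wc: "word w \<in> carrier S" if "f w \<noteq> \<zero>" for w
    using that fD(3) by (intro word_closed) auto
  have g: "?g w = (case w of [] \<Rightarrow> \<zero> | y # v \<Rightarrow> if y = x then f v else \<zero>)" for w
    by (simp add: R.fa_var_mult[OF f])
  \<comment> \<open>Prefixing \<open>x\<close> is injective on words and carries the support of
    \<open>f\<close> onto that of the product, so the sum can be reindexed.\<close>
  have W: "{w. ?g w \<noteq> \<zero>} = (#) x ` ?W"
  proof (rule Set.set_eqI)
    show "w \<in> {w. ?g w \<noteq> \<zero>} \<longleftrightarrow> w \<in> (#) x ` ?W" for w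
      by (cases w) (auto simp: g)
  qed
  have "eval_at ?g = (\<Oplus>\<^bsub>S\<^esub>w\<in>(#) x ` ?W. \<sigma> (?g w) \<otimes>\<^bsub>S\<^esub> word w)"
    unfolding eval_at_def W ..
  also have "\<dots> = (\<Oplus>\<^bsub>S\<^esub>w\<in>?W. \<sigma> (?g (x # w)) \<otimes>\<^bsub>S\<^esub> word (x # w))"
    using wc fD x var_closed[OF x] by (subst S.finsum_reindex) (auto simp: g word_def)
  also have "\<dots> = (\<Oplus>\<^bsub>S\<^esub>w\<in>?W. \<phi> x \<otimes>\<^bsub>S\<^esub> (\<sigma> (f w) \<otimes>\<^bsub>S\<^esub> word w))"
  proof (rule S.finsum_cong')
    fix w assume "w \<in> ?W"
    then have w: "f w \<noteq> \<zero>" by simp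
    have "word (x # w) = \<phi> x \<otimes>\<^bsub>S\<^esub> word w" by (simp add: word_def)
    then show "\<sigma> (?g (x # w)) \<otimes>\<^bsub>S\<^esub> word (x # w) = \<phi> x \<otimes>\<^bsub>S\<^esub> (\<sigma> (f w) \<otimes>\<^bsub>S\<^esub> word w)"
      using wc[OF w] var_closed[OF x] fD(1)[of w] commute[OF fD(1) x, of w]
      by (simp add: g flip: S.m_assoc)
  qed (use wc fD var_closed[OF x] in auto)
  also have "\<dots> = \<phi> x \<otimes>\<^bsub>S\<^esub> eval_at f"
    unfolding eval_at_def using wc fD var_closed[OF x] by (subst S.finsum_rdistr) auto
  finally show ?thesis .
qed

lemma eval_const: "r \<in> carrier R \<Longrightarrow> eval_at (fa_const R r) = \<sigma> r"
proof -
  assume r: "r \<in> carrier R"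
  have "eval_at (fa_const R r) = (\<Oplus>\<^bsub>S\<^esub>w\<in>{[]}. \<sigma> (fa_const R r w) \<otimes>\<^bsub>S\<^esub> word w)"
    by (rule eval_superset[OF R.fa_const_closed[OF r]]) (auto simp: fa_const_def)
  also have "\<dots> = \<sigma> r" using r by (simp add: fa_const_def word_def)
  finally show ?thesis .
qed

lemma eval_one: "eval_at \<one>\<^bsub>free_algebra R V\<^esub> = \<one>\<^bsub>S\<^esub>"
  using eval_const[OF R.one_closed] ring_hom_one[OF R.fa_const_hom[of V]] by simp

lemma eval_var: "x \<in> V \<Longrightarrow> eval_at (fa_var R x) = \<phi> x"
proof -
  assume x: "x \<in> V"
  interpret A: ring "free_algebra R V" by (rule R.free_algebra_is_ring)
  show ?thesis
    using eval_var_mult[OF x A.one_closed] R.fa_var_closed[OF x] var_closed[OF x]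
    by (simp add: eval_one)
qed

lemma eval_hom: "eval_at \<in> ring_hom (free_algebra R V) S"
proof (rule ring_hom_memI)
  interpret A: ring "free_algebra R V" by (rule R.free_algebra_is_ring)
  fix f g assume f: "f \<in> carrier (free_algebra R V)" and g: "g \<in> carrier (free_algebra R V)"
  \<comment> \<open>Induction on the left factor suffices: its cases are the two multiplication
    rules above and additivity.\<close>
  from f show "eval_at (f \<otimes>\<^bsub>free_algebra R V\<^esub> g) = eval_at f \<otimes>\<^bsub>S\<^esub> eval_at g"
  proof (induction rule: R.free_algebra_induct)
    case (const r)
    then show ?case by (simp add: eval_const_mult eval_const g)
  next
    case (var x f)
    then show ?case
      using A.m_assoc[OF R.fa_var_closed var(2) g] var_closed
      by (simp add: eval_var_mult g eval_closed S.m_assoc)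
  next
    case (add f f')
    then show ?case by (simp add: A.l_distr eval_add g eval_closed S.l_distr)
  qed
qed (simp_all add: eval_closed eval_add eval_one)

end

section \<open>The integers as initial ring\<close>

lemma int_hom_ring:
  assumes "ring S"
  shows "(\<lambda>n::int. add_pow S n \<one>\<^bsub>S\<^esub>) \<in> ring_hom \<Z> S"
proof -
  interpret S: ring S by fact
  show ?thesis
  proof (rule ring_hom_memI)
    fix m n :: int
    show "add_pow S (m \<otimes>\<^bsub>\<Z>\<^esub> n) \<one>\<^bsub>S\<^esub> =
        add_pow S m \<one>\<^bsub>S\<^esub> \<otimes>\<^bsub>S\<^esub> add_pow S n \<one>\<^bsub>S\<^esub>"
      using S.add.int_pow_pow[of "\<one>\<^bsub>S\<^esub>" m n]
      by (simp add: S.add_pow_ldistr_int mult.commute[of m n])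
    show "add_pow S m \<one>\<^bsub>S\<^esub> \<in> carrier S"
      by (rule S.add.int_pow_closed) simp
    show "add_pow S (m \<oplus>\<^bsub>\<Z>\<^esub> n) \<one>\<^bsub>S\<^esub> =
        add_pow S m \<one>\<^bsub>S\<^esub> \<oplus>\<^bsub>S\<^esub> add_pow S n \<one>\<^bsub>S\<^esub>"
      using S.add.int_pow_mult[of "\<one>\<^bsub>S\<^esub>" m n] by simp
  next
    show "add_pow S \<one>\<^bsub>\<Z>\<^esub> \<one>\<^bsub>S\<^esub> = \<one>\<^bsub>S\<^esub>"
      using S.add.int_pow_1[of "\<one>\<^bsub>S\<^esub>"] by simp
  qed
qed

lemma int_hom_unique:
  assumes "ring S" "g \<in> ring_hom \<Z> S" "h \<in> ring_hom \<Z> S"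
  shows "g n = h n"
proof -
  note Z = cring.axioms(1)[OF int_is_cring]
  interpret S: ring S by fact
  interpret g: ring_hom_ring \<Z> S g
    by (rule ring_hom_ringI2) (use assms Z in auto)
  interpret h: ring_hom_ring \<Z> S h
    by (rule ring_hom_ringI2) (use assms Z in auto)
  have minus: "g (- 1) = h (- 1)"
    using g.hom_a_inv[of 1] h.hom_a_inv[of 1] g.hom_one h.hom_one by simp
  show ?thesis
  proof (induction n rule: int_induct[where k = 0])
    case base
    then show ?case using g.hom_zero h.hom_zero by simp
  next
    case (step1 i)
    then show ?case using g.hom_add[of i 1] h.hom_add[of i 1] g.hom_one h.hom_one by simp
  next
    case (step2 i)
    then show ?case using g.hom_add[of i "- 1"] h.hom_add[of i "- 1"] minus by simp
  qed
qed

section \<open>The universal property of the ring of general polynomials\<close>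

lemma general_poly_carrier:
  "carrier (general_poly D) = (+>\<^bsub>gp_free D\<^esub>) (gp_ideal D) ` carrier (gp_free D)"
  by (auto simp: general_poly_def FactRing_def A_RCOSETS_def')

lemma general_poly_proj_hom:
  "ring D \<Longrightarrow> (+>\<^bsub>gp_free D\<^esub>) (gp_ideal D) \<in> ring_hom (gp_free D) (general_poly D)"
  unfolding general_poly_def by (rule ideal.rcos_ring_hom[OF gp_ideal_is_ideal])

text \<open>The free ring over the integers is evaluated with \<open>\<sigma>\<close> on the
  coefficients and \<open>s\<close> at \<open>Z\<close>. The assumptions make every relation
  evaluate to zero, so the ideal lies in the kernel and the evaluation descends to cosets.\<close>

lemma general_poly_hom_exists:
  assumes D: "ring D" and S: "ring S" and \<sigma>: "\<sigma> \<in> ring_hom D S" and s: "s \<in> carrier S"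
    and comm: "\<And>c. c \<in> ring_center D \<Longrightarrow> \<sigma> c \<otimes>\<^bsub>S\<^esub> s = s \<otimes>\<^bsub>S\<^esub> \<sigma> c"
  obtains h where "h \<in> ring_hom (general_poly D) S"
    and "\<And>d. d \<in> carrier D \<Longrightarrow> h (gp_const D d) = \<sigma> d" and "h (gp_z D) = s"
proof -
  let ?V = "insert Z (Coeff ` carrier D)"
  let ?\<phi> = "case_gen \<sigma> s" and ?\<iota> = "\<lambda>n::int. add_pow S n \<one>\<^bsub>S\<^esub>"
  let ?\<pi> = "(+>\<^bsub>gp_free D\<^esub>) (gp_ideal D)"
  interpret D: ring D by fact
  interpret S: ring S by fact
  interpret P: ring "gp_free D" by (rule gp_free_is_ring)
  interpret I: ideal "gp_ideal D" "gp_free D" by (rule gp_ideal_is_ideal[OF D])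
  note \<pi> = general_poly_proj_hom[OF D]
  interpret \<iota>: ring_hom_ring \<Z> S ?\<iota>
    by (rule ring_hom_ringI2) (use int_hom_ring[OF S] S cring.axioms(1)[OF int_is_cring] in auto)
  have \<phi>: "?\<phi> x \<in> carrier S" if "x \<in> ?V" for x
    using that s ring_hom_closed[OF \<sigma>] by auto
  interpret E: free_algebra_eval \<Z> S ?\<iota> ?V ?\<phi>
  proof unfold_locales
    show "?\<phi> x \<in> carrier S" if "x \<in> ?V" for x
      using that by (rule \<phi>)
    \<comment> \<open>Integer multiples of the unit commute with everything in
      \<open>S\<close>.\<close>
    show "?\<iota> r \<otimes>\<^bsub>S\<^esub> ?\<phi> x = ?\<phi> x \<otimes>\<^bsub>S\<^esub> ?\<iota> r" if "x \<in> ?V" for r x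
      using \<phi>[OF that] S.add_pow_ldistr_int[of "\<one>\<^bsub>S\<^esub>" "?\<phi> x" r]
        S.add_pow_rdistr_int[of "?\<phi> x" "\<one>\<^bsub>S\<^esub>" r] by simp
  qed
  interpret e: ring_hom_ring "gp_free D" S E.eval_at
    by (rule ring_hom_ringI2)
      (use E.eval_hom in \<open>auto simp: S gp_free_is_ring simp flip: gp_free_def\<close>)
  note v = fa_var_gp_free[of D] fa_var_gp_free(2)[of _ D]
  have eZ: "E.eval_at (fa_var \<Z> Z) = s"
    using E.eval_var[of Z] by simp
  have eC: "E.eval_at (fa_var \<Z> (Coeff d)) = \<sigma> d" if "d \<in> carrier D" for d
    using E.eval_var[of "Coeff d"] that by simp
  have eminus: "E.eval_at (x \<ominus>\<^bsub>gp_free D\<^esub> y) = \<zero>\<^bsub>S\<^esub>"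
    if "x \<in> carrier (gp_free D)" "y \<in> carrier (gp_free D)" "E.eval_at x = E.eval_at y" for x y
    using that by (simp add: P.minus_eq S.r_neg)
  have center: "c \<in> carrier D" if "c \<in> ring_center D" for c
    using that by (simp add: ring_center_def)
  have "E.eval_at u = \<zero>\<^bsub>S\<^esub>" if "u \<in> gp_relations D" for u
    using that unfolding gp_relations_def Let_def
    by (elim UnE CollectE exE conjE singletonE)
      (simp_all add: eminus center eC eZ v ring_hom_add[OF \<sigma>] ring_hom_mult[OF \<sigma>]
        ring_hom_one[OF \<sigma>] comm)
  then have "gp_relations D \<subseteq> a_kernel (gp_free D) S E.eval_at"
    using gp_relations_closed[OF D] unfolding a_kernel_def' by blast
  then have ker: "gp_ideal D \<subseteq> a_kernel (gp_free D) S E.eval_at"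
    unfolding gp_ideal_def by (rule P.genideal_minimal[OF e.kernel_is_ideal])
  \<comment> \<open>The evaluation is constant on each coset, so the image of a coset is a singleton
    and \<open>the_elem\<close> reads off its value.\<close>
  define h where "h X = the_elem (E.eval_at ` X)" for X
  have h: "h (?\<pi> x) = E.eval_at x" if x: "x \<in> carrier (gp_free D)" for x
  proof -
    have "E.eval_at y = E.eval_at x" if y: "y \<in> ?\<pi> x" for y
    proof -
      obtain i where i: "i \<in> gp_ideal D" "y = i \<oplus>\<^bsub>gp_free D\<^esub> x"
        using y unfolding a_r_coset_def' by blast
      have "i \<in> carrier (gp_free D)" "E.eval_at i = \<zero>\<^bsub>S\<^esub>"
        using ker i(1) unfolding a_kernel_def' by blast+
      then show ?thesis using i(2) x by simp
    qed
    moreover have "x \<in> ?\<pi> x" by (rule I.a_rcos_self[OF x])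
    ultimately have "E.eval_at ` ?\<pi> x = {E.eval_at x}" by blast
    then show ?thesis by (simp add: h_def)
  qed
  show thesis
  proof
    show "h \<in> ring_hom (general_poly D) S"
    proof (rule ring_hom_memI)
      show "h \<one>\<^bsub>general_poly D\<^esub> = \<one>\<^bsub>S\<^esub>"
        using ring_hom_one[OF \<pi>] h[OF P.one_closed] by simp
    next
      fix X Y assume "X \<in> carrier (general_poly D)" "Y \<in> carrier (general_poly D)"
      then obtain x y where X: "X = ?\<pi> x" "x \<in> carrier (gp_free D)"
        and Y: "Y = ?\<pi> y" "y \<in> carrier (gp_free D)"
        unfolding general_poly_carrier by blast
      show "h X \<in> carrier S"
        using X by (simp add: h)
      show "h (X \<otimes>\<^bsub>general_poly D\<^esub> Y) = h X \<otimes>\<^bsub>S\<^esub> h Y"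
        using X Y ring_hom_mult[OF \<pi> X(2) Y(2)] h[OF P.m_closed[OF X(2) Y(2)]] by (simp add: h)
      show "h (X \<oplus>\<^bsub>general_poly D\<^esub> Y) = h X \<oplus>\<^bsub>S\<^esub> h Y"
        using X Y ring_hom_add[OF \<pi> X(2) Y(2)] h[OF P.a_closed[OF X(2) Y(2)]] by (simp add: h)
    qed
    show "h (gp_const D d) = \<sigma> d" if "d \<in> carrier D" for d
      using that by (simp add: gp_const_def h v eC)
    show "h (gp_z D) = s"
      by (simp add: gp_z_def h v eZ)
  qed
qed

lemma general_poly_hom_unique:
  assumes D: "ring D" and S: "ring S"
    and g: "g \<in> ring_hom (general_poly D) S" and h: "h \<in> ring_hom (general_poly D) S"
    and const: "\<And>d. d \<in> carrier D \<Longrightarrow> g (gp_const D d) = h (gp_const D d)"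
    and z: "g (gp_z D) = h (gp_z D)"
    and u: "u \<in> carrier (general_poly D)"
  shows "g u = h u"
proof -
  let ?V = "insert Z (Coeff ` carrier D)"
  let ?\<pi> = "(+>\<^bsub>gp_free D\<^esub>) (gp_ideal D)"
  note int = cring.axioms(1)[OF int_is_cring]
  note \<pi> = general_poly_proj_hom[OF D]
  have g\<pi>: "g \<circ> ?\<pi> \<in> ring_hom (free_algebra \<Z> ?V) S" and h\<pi>: "h \<circ> ?\<pi> \<in> ring_hom (free_algebra \<Z> ?V) S"
    using ring_hom_trans[OF \<pi> g] ring_hom_trans[OF \<pi> h] by (simp_all add: gp_free_def)
  note c = ring.fa_const_hom[OF int, of ?V]
  obtain x where x: "x \<in> carrier (gp_free D)" "u = ?\<pi> x"
    using u by (auto simp: general_poly_carrier)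
  have "(g \<circ> ?\<pi>) x = (h \<circ> ?\<pi>) x"
  proof (rule free_algebra_hom_unique[OF int S g\<pi> h\<pi>])
    \<comment> \<open>Agreement on integer constants is automatic, since there is only one
      homomorphism from the integers to \<open>S\<close>.\<close>
    show "(g \<circ> ?\<pi>) (fa_const \<Z> r) = (h \<circ> ?\<pi>) (fa_const \<Z> r)" for r
      using int_hom_unique[OF S ring_hom_trans[OF c g\<pi>] ring_hom_trans[OF c h\<pi>], of r] by simp
    show "(g \<circ> ?\<pi>) (fa_var \<Z> y) = (h \<circ> ?\<pi>) (fa_var \<Z> y)" if "y \<in> ?V" for y
      using that const z by (auto simp: gp_const_def gp_z_def)
    show "x \<in> carrier (free_algebra \<Z> ?V)" using x by (simp add: gp_free_def)
  qed
  with x show ?thesis by simp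
qed

section \<open>Sandwich operators\<close>

lemma (in abelian_monoid) finsum_swap:
  assumes "finite A" "finite B" "\<And>i j. \<lbrakk>i \<in> A; j \<in> B\<rbrakk> \<Longrightarrow> f i j \<in> carrier G"
  shows "(\<Oplus>i\<in>A. \<Oplus>j\<in>B. f i j) = (\<Oplus>j\<in>B. \<Oplus>i\<in>A. f i j)"
  using assms(1,3)
proof (induction A)
  case empty
  then show ?case by simp
next
  case (insert a A)
  have "(\<Oplus>i\<in>insert a A. \<Oplus>j\<in>B. f i j) = (\<Oplus>j\<in>B. f a j) \<oplus> (\<Oplus>j\<in>B. \<Oplus>i\<in>A. f i j)"
    using insert by (subst finsum_insert) (auto intro!: finsum_closed)
  also have "\<dots> = (\<Oplus>j\<in>B. f a j \<oplus> (\<Oplus>i\<in>A. f i j))"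
    using insert by (subst finsum_addf) (auto intro!: finsum_closed)
  also have "\<dots> = (\<Oplus>j\<in>B. \<Oplus>i\<in>insert a A. f i j)"
    using insert by (intro finsum_cong') (auto intro!: finsum_closed)
  finally show ?case .
qed

text \<open>A spanning list is thinned to an independent list, keeping an entry only if it lies
  outside the span of those already kept. A base of \<open>E\<close> lies in the span of the result,
  so \<open>independent_length_le\<close> bounds its length.\<close>

lemma (in ring) dimension_le_length:
  assumes K: "subfield K R" and E: "dimension n K E"
    and Ws: "set Ws \<subseteq> carrier R" "E \<subseteq> Span K Ws"
  shows "n \<le> length Ws"
proof -
  have "\<exists>Vs. independent K Vs \<and> length Vs \<le> length Ws \<and> Span K Ws \<subseteq> Span K Vs"
    using Ws(1)
  proof (induction Ws)
    case Nil
    then show ?case by (intro exI[of _ "[]"]) simp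
  next
    case (Cons w Ws)
    then have Ws_carrier: "set Ws \<subseteq> carrier R" and w: "w \<in> carrier R" by auto
    from Cons.IH[OF Ws_carrier] obtain Vs
      where Vs: "independent K Vs" "length Vs \<le> length Ws" "Span K Ws \<subseteq> Span K Vs"
      by blast
    note Vs_carrier = independent_in_carrier[OF Vs(1)]
    have Ws: "set Ws \<subseteq> Span K Vs"
      using Span_base_incl[OF K Ws_carrier] Vs(3) by (rule subset_trans)
    show ?case
    proof (cases "w \<in> Span K Vs")
      case True
      with Ws have "set (w # Ws) \<subseteq> Span K Vs" unfolding list.set by blast
      from mono_Span_subset[OF K this Vs_carrier] Vs(1,2) show ?thesis
        by (metis le_SucI length_Cons)
    next
      case False
      have wVs: "set (w # Vs) \<subseteq> carrier R"
        unfolding list.set using w Vs_carrier by blast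
      have "set (w # Ws) \<subseteq> Span K (w # Vs)"
        using Ws mono_Span[OF K Vs_carrier w] Span_base_incl[OF K wVs]
        unfolding list.set by blast
      from mono_Span_subset[OF K this wVs] li_Cons[OF w False Vs(1)] Vs(2) show ?thesis
        by (metis Suc_le_mono length_Cons)
    qed
  qed
  then obtain Vs where Vs: "independent K Vs" "length Vs \<le> length Ws" "Span K Ws \<subseteq> Span K Vs"
    by blast
  obtain Bs where Bs: "set Bs \<subseteq> carrier R" "independent K Bs" "length Bs = n" "Span K Bs = E"
    using exists_base[OF K E] by blast
  have "set Bs \<subseteq> Span K Vs"
    using Span_base_incl[OF K Bs(1)] Bs(4) Ws(2) Vs(3) by blast
  then have "n \<le> length Vs"
    using independent_length_le[OF K Bs(2) Vs(1)] Bs(3) by simp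
  with Vs(2) show ?thesis by simp
qed

lemma (in ring) centerD:
  assumes "c \<in> ring_center R"
  shows "c \<in> carrier R" "x \<in> carrier R \<Longrightarrow> c \<otimes> x = x \<otimes> c"
  using assms by (auto simp: ring_center_def)

section \<open>The center of a skew field and density\<close>

context skew_field begin

lemma inv_nonzero:
  assumes "x \<in> carrier R" "x \<noteq> \<zero>"
  shows "inv x \<in> carrier R" "inv x \<otimes> x = \<one>" "x \<otimes> inv x = \<one>"
  using assms Units_eq by (auto intro: Units_inv_closed Units_l_inv Units_r_inv)

lemma inv_center:
  assumes c: "c \<in> ring_center R" "c \<noteq> \<zero>"
  shows "inv c \<in> ring_center R"
proof -
  note i = inv_nonzero[OF centerD(1)[OF c(1)] c(2)] and cc = centerD[OF c(1)]
  have "inv c \<otimes> x = x \<otimes> inv c" if x: "x \<in> carrier R" for x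
  proof -
    have "inv c \<otimes> x = inv c \<otimes> (x \<otimes> c) \<otimes> inv c"
      using i cc(1) x by (simp add: m_assoc)
    also have "\<dots> = (inv c \<otimes> c) \<otimes> x \<otimes> inv c"
      unfolding cc(2)[OF x, symmetric] using i(1) cc(1) x by (simp add: m_assoc)
    finally show ?thesis using i x by simp
  qed
  with i(1) show ?thesis by (simp add: ring_center_def)
qed

text \<open>Makes \<open>Span\<close> and \<open>dimension\<close> over the center
  available.\<close>

lemma center_subfield: "subfield (ring_center R) R"
proof (rule subfieldI)
  have mult: "x \<otimes> y \<in> ring_center R" if x: "x \<in> ring_center R" and y: "y \<in> ring_center R" for x y
  proof -
    have "x \<otimes> y \<otimes> r = r \<otimes> (x \<otimes> y)" if r: "r \<in> carrier R" for r
      using centerD[OF x] centerD[OF y] r by (metis m_assoc)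
    with centerD(1)[OF x] centerD(1)[OF y] show ?thesis by (simp add: ring_center_def)
  qed
  show sub: "subcring (ring_center R) R"
  proof (rule subcringI)
    show "subring (ring_center R) R"
      by (rule subringI) (auto simp: mult, auto simp: ring_center_def l_distr r_distr l_minus r_minus)
  qed (auto simp: centerD)
  show "Units (R\<lparr>carrier := ring_center R\<rparr>) = ring_center R - {\<zero>}"
  proof (rule Set.set_eqI)
    fix x
    have "\<exists>y\<in>ring_center R. y \<otimes> x = \<one> \<and> x \<otimes> y = \<one>" if "x \<in> ring_center R" "x \<noteq> \<zero>"
      using inv_center[OF that] inv_nonzero[OF centerD(1)[OF that(1)] that(2)] by blast
    moreover have "y \<otimes> \<zero> \<noteq> \<one>" if "y \<in> ring_center R" for y
      using centerD(1)[OF that] one_not_zero by simp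
    ultimately show "x \<in> Units (R\<lparr>carrier := ring_center R\<rparr>) \<longleftrightarrow> x \<in> ring_center R - {\<zero>}"
      unfolding Units_def by (simp, blast)
  qed
qed

text \<open>A variant of the Jacobson density theorem for \<open>R\<close> as an \<open>R\<close>-\<open>R\<close>-bimodule. If every \<open>f \<in> T\<close>
  vanishing at the \<open>b i\<close> also vanished at a further \<open>b k\<close>, then the value at \<open>b k\<close> of each \<open>f\<close> would
  be \<open>\<Oplus>i. f (b i) \<otimes> t i (b k)\<close>, where \<open>t\<close> is dual to \<open>b\<close>. Multiplying \<open>t i\<close> on the right shows
  that the \<open>t i (b k)\<close> are central, so for the identity \<open>f\<close> this is a linear dependency.\<close>

lemma density:
  assumes closed: "\<And>f x. \<lbrakk>f \<in> T; x \<in> carrier R\<rbrakk> \<Longrightarrow> f x \<in> carrier R"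
    and id: "(\<lambda>x. x) \<in> T" and zero: "(\<lambda>x. \<zero>) \<in> T"
    and add: "\<And>f g. \<lbrakk>f \<in> T; g \<in> T\<rbrakk> \<Longrightarrow> (\<lambda>x. f x \<oplus> g x) \<in> T"
    and lmult: "\<And>f e. \<lbrakk>f \<in> T; e \<in> carrier R\<rbrakk> \<Longrightarrow> (\<lambda>x. e \<otimes> f x) \<in> T"
    and rmult: "\<And>f e. \<lbrakk>f \<in> T; e \<in> carrier R\<rbrakk> \<Longrightarrow> (\<lambda>x. f x \<otimes> e) \<in> T"
    and "finite J" and "b \<in> J \<rightarrow> carrier R"
    and "\<And>k I c. \<lbrakk>k \<in> J; I \<subseteq> J - {k}; c \<in> I \<rightarrow> ring_center R\<rbrakk> \<Longrightarrow> b k \<noteq> (\<Oplus>i\<in>I. b i \<otimes> c i)"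
  shows "\<forall>k\<in>J. \<exists>f\<in>T. \<forall>i\<in>J. f (b i) = (if i = k then \<one> else \<zero>)"
  using assms(7-9)
proof (induction J)
  case empty
  then show ?case by simp
next
  case (insert n J)
  have b: "b n \<in> carrier R" "\<And>i. i \<in> J \<Longrightarrow> b i \<in> carrier R" using insert.prems(1) by auto
  have "\<forall>k\<in>J. \<exists>f\<in>T. \<forall>i\<in>J. f (b i) = (if i = k then \<one> else \<zero>)"
  proof (rule insert.IH)
    show "b k \<noteq> (\<Oplus>i\<in>I. b i \<otimes> c i)"
      if "k \<in> J" "I \<subseteq> J - {k}" "c \<in> I \<rightarrow> ring_center R" for k I c
      using that by (intro insert.prems(2)) auto
  qed (use b in simp)
  then obtain t where t: "\<And>k. k \<in> J \<Longrightarrow> t k \<in> T"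
    "\<And>k i. \<lbrakk>k \<in> J; i \<in> J\<rbrakk> \<Longrightarrow> t k (b i) = (if i = k then \<one> else \<zero>)"
    by metis
  \<comment> \<open>Closure under finite combinations is claimed only up to agreement on the
    carrier, because the values summed by \<open>finsum\<close> are known to be closed only for
    arguments there.\<close>
  have comb: "(\<lambda>x. \<Oplus>i\<in>I. e i \<otimes> t i x) \<in> {f. \<exists>g\<in>T. \<forall>x\<in>carrier R. f x = g x}"
    if "I \<subseteq> J" "e \<in> J \<rightarrow> carrier R" for I e
    using finite_subset[OF that(1) insert.hyps(1)] that(1)
  proof (induction I)
    case empty
    then show ?case using zero by auto
  next
    case (insert j I)
    then obtain g where g: "g \<in> T" "\<And>x. x \<in> carrier R \<Longrightarrow> (\<Oplus>i\<in>I. e i \<otimes> t i x) = g x" by auto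
    have j: "t j \<in> T" "e j \<in> carrier R" using insert.prems t(1) that(2) by auto
    have "(\<Oplus>i\<in>insert j I. e i \<otimes> t i x) = e j \<otimes> t j x \<oplus> g x" if "x \<in> carrier R" for x
      using insert.hyps insert.prems j g(2)[OF that] t(1) closed that \<open>e \<in> J \<rightarrow> carrier R\<close>
      by (subst finsum_insert) (auto simp: subset_iff Pi_iff)
    then show ?case
      using add[OF lmult[OF j] g(1)]
      by (intro CollectI bexI[of _ "\<lambda>x. e j \<otimes> t j x \<oplus> g x"]) simp_all
  qed
  have "\<exists>s\<in>T. (\<forall>j\<in>J. s (b j) = \<zero>) \<and> s (b n) \<noteq> \<zero>"
  proof (rule ccontr)
    assume no: "\<not> ?thesis"
    define c where "c i = t i (b n)" for i
    have c: "c i \<in> carrier R" if "i \<in> J" for i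
      using that t(1) closed b by (simp add: c_def)
    have eval: "f (b n) = (\<Oplus>i\<in>J. f (b i) \<otimes> c i)" if f: "f \<in> T" for f
    proof -
      have fb: "f (b i) \<in> carrier R" if "i \<in> J" for i using that f closed b by blast
      obtain g where g: "g \<in> T" "\<And>x. x \<in> carrier R \<Longrightarrow> (\<Oplus>i\<in>J. f (b i) \<otimes> t i x) = g x"
        using comb[of J "\<lambda>i. f (b i)"] fb by auto
      \<comment> \<open>\<open>g\<close> agrees with \<open>f\<close> at every \<open>b j\<close>
        with \<open>j\<close> in \<open>J\<close>, so the difference vanishes there; by
        \<open>no\<close> it then vanishes at \<open>b n\<close> as well.\<close>
      define s where "s = (\<lambda>x. f x \<oplus> (\<ominus> \<one>) \<otimes> g x)"
      have s: "s \<in> T" unfolding s_def by (intro add f lmult g) simp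
      have sx: "s x = f x \<ominus> g x" if "x \<in> carrier R" for x
        using closed[OF g(1) that] by (simp add: s_def l_minus minus_eq)
      have "s (b j) = \<zero>" if j: "j \<in> J" for j
      proof -
        have "g (b j) = (\<Oplus>i\<in>J. if j = i then f (b i) else \<zero>)"
          unfolding g(2)[OF b(2)[OF j], symmetric] using fb t(2) j
          by (intro finsum_cong') auto
        also have "\<dots> = f (b j)"
          using fb j insert.hyps by (intro finsum_singleton) auto
        finally show ?thesis using fb[OF j] b(2)[OF j] by (simp add: sx minus_eq r_neg)
      qed
      with no s have "s (b n) = \<zero>" by blast
      then have "f (b n) = g (b n)"
        using sx[OF b(1)] closed[OF f b(1)] closed[OF g(1) b(1)] by simp
      then show ?thesis using g(2)[OF b(1)] by (simp add: c_def)
    qed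
    have "c i \<in> ring_center R" if i: "i \<in> J" for i
    proof -
      have "c i \<otimes> d = d \<otimes> c i" if d: "d \<in> carrier R" for d
      proof -
        have "c i \<otimes> d = (\<Oplus>j\<in>J. t i (b j) \<otimes> d \<otimes> c j)"
          using eval[OF rmult[OF t(1)[OF i] d]] by (simp add: c_def)
        also have "\<dots> = (\<Oplus>j\<in>J. if i = j then d \<otimes> c j else \<zero>)"
          using i d c t(2) by (intro finsum_cong') auto
        also have "\<dots> = d \<otimes> c i"
          using i d c insert.hyps by (intro finsum_singleton) auto
        finally show ?thesis .
      qed
      with c[OF i] show ?thesis by (simp add: ring_center_def)
    qed
    with insert.prems(2)[of n J c] insert.hyps(2) eval[OF id] show False by auto
  qed
  then obtain s where s: "s \<in> T" "\<And>j. j \<in> J \<Longrightarrow> s (b j) = \<zero>" "s (b n) \<noteq> \<zero>" by blast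
  note i = inv_nonzero[OF closed[OF s(1) b(1)] s(3)]
  define s' where "s' = (\<lambda>x. inv (s (b n)) \<otimes> s x)"
  have s': "s' \<in> T" "\<And>j. j \<in> J \<Longrightarrow> s' (b j) = \<zero>" "s' (b n) = \<one>"
    using s i lmult by (auto simp: s'_def)
  have "\<exists>f\<in>T. \<forall>i\<in>insert n J. f (b i) = (if i = k then \<one> else \<zero>)" if k: "k \<in> insert n J" for k
  proof (cases "k = n")
    case True
    with s' insert.hyps show ?thesis by (intro bexI[of _ s']) auto
  next
    case False
    with k have k: "k \<in> J" by simp
    have tk: "t k (b n) \<in> carrier R" using k t(1) closed b by blast
    \<comment> \<open>The old dual operator is corrected at the new point \<open>b n\<close> by a
      multiple of \<open>s'\<close>; its values on the old points stay the same, since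
      \<open>s'\<close> vanishes there.\<close>
    have "(\<lambda>x. t k x \<oplus> (\<ominus> t k (b n)) \<otimes> s' x) \<in> T"
      using k t(1) s' tk by (intro add lmult) auto
    then show ?thesis
      using k tk t(2) s' insert.hyps False
      by (intro bexI[of _ "\<lambda>x. t k x \<oplus> (\<ominus> t k (b n)) \<otimes> s' x"]) (auto simp: r_neg l_minus)
  qed
  then show ?case by blast
qed

end

text \<open>The tuple \<open>u\<close> stands for the element \<Sum> \<open>u l\<close> \<otimes>
  \<open>b l\<close> of the tensor product of \<open>D\<close> with itself over the center. The
  parameter \<open>\<sigma>\<close> lets the same tuple act on \<open>D\<close> and on any ring that
  receives a homomorphism from \<open>D\<close>.\<close>

definition sandwich ::
  "('c, 'n) ring_scheme \<Rightarrow> ('a \<Rightarrow> 'c) \<Rightarrow> (nat \<Rightarrow> 'a) \<Rightarrow> nat \<Rightarrow> (nat \<Rightarrow> 'a) \<Rightarrow> 'c \<Rightarrow> 'c" where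
  "sandwich S \<sigma> b n u z = (\<Oplus>\<^bsub>S\<^esub>l\<in>{..<n}. \<sigma> (u l) \<otimes>\<^bsub>S\<^esub> z \<otimes>\<^bsub>S\<^esub> \<sigma> (b l))"

text \<open>Independence ranges over arbitrary index subsets \<open>I\<close>, so that subfamilies
  inherit it, as the induction in \<open>density\<close> demands.\<close>

locale central_basis = skew_field +
  fixes b :: "nat \<Rightarrow> 'a" and n :: nat
  assumes b_closed: "i < n \<Longrightarrow> b i \<in> carrier R"
    and n_pos: "0 < n" and b_0: "b 0 = \<one>"
    and span: "x \<in> carrier R \<Longrightarrow>
      \<exists>c\<in>{..<n} \<rightarrow> ring_center R. x = (\<Oplus>i\<in>{..<n}. b i \<otimes> c i)"
    and indep: "\<lbrakk>k < n; I \<subseteq> {..<n} - {k}; c \<in> I \<rightarrow> ring_center R\<rbrakk> \<Longrightarrow> b k \<noteq> (\<Oplus>i\<in>I. b i \<otimes> c i)"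

text \<open>The instances are \<open>D\<close> with the identity, the general polynomials with
  \<open>gp_const\<close>, and the free algebra with \<open>fa_const\<close>.\<close>

locale central_basis_hom = R?: central_basis R b n + ring_hom_ring R S \<sigma>
  for R (structure) and b n and S (structure) and \<sigma>
begin

lemma sandwich_closed:
  "\<lbrakk>u \<in> {..<n} \<rightarrow> carrier R; z \<in> carrier S\<rbrakk> \<Longrightarrow> sandwich S \<sigma> b n u z \<in> carrier S"
  unfolding sandwich_def by (intro S.finsum_closed) (auto simp: b_closed Pi_iff)

lemma sandwich_cong:
  assumes "u \<in> {..<n} \<rightarrow> carrier R" "z \<in> carrier S" "\<And>l. l < n \<Longrightarrow> u l = v l"
  shows "sandwich S \<sigma> b n u z = sandwich S \<sigma> b n v z"
  unfolding sandwich_def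
  by (intro S.finsum_cong') (use assms b_closed in \<open>auto simp: Pi_iff\<close>)

lemma sandwich_add:
  assumes "u \<in> {..<n} \<rightarrow> carrier R" "v \<in> {..<n} \<rightarrow> carrier R" "z \<in> carrier S"
  shows "sandwich S \<sigma> b n u z \<oplus>\<^bsub>S\<^esub> sandwich S \<sigma> b n v z = sandwich S \<sigma> b n (\<lambda>l. u l \<oplus> v l) z"
proof -
  have "sandwich S \<sigma> b n (\<lambda>l. u l \<oplus> v l) z =
      (\<Oplus>\<^bsub>S\<^esub>l\<in>{..<n}. \<sigma> (u l) \<otimes>\<^bsub>S\<^esub> z \<otimes>\<^bsub>S\<^esub> \<sigma> (b l) \<oplus>\<^bsub>S\<^esub> \<sigma> (v l) \<otimes>\<^bsub>S\<^esub> z \<otimes>\<^bsub>S\<^esub> \<sigma> (b l))"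
    unfolding sandwich_def using assms b_closed
    by (intro S.finsum_cong') (auto simp: Pi_iff S.l_distr)
  then show ?thesis
    unfolding sandwich_def using assms b_closed by (subst (asm) S.finsum_addf) (auto simp: Pi_iff)
qed

lemma sandwich_lmult:
  assumes u: "u \<in> {..<n} \<rightarrow> carrier R" and z: "z \<in> carrier S" and e: "e \<in> carrier R"
  shows "\<sigma> e \<otimes>\<^bsub>S\<^esub> sandwich S \<sigma> b n u z = sandwich S \<sigma> b n (\<lambda>l. e \<otimes> u l) z"
proof -
  have "\<sigma> e \<otimes>\<^bsub>S\<^esub> sandwich S \<sigma> b n u z =
      (\<Oplus>\<^bsub>S\<^esub>l\<in>{..<n}. \<sigma> e \<otimes>\<^bsub>S\<^esub> (\<sigma> (u l) \<otimes>\<^bsub>S\<^esub> z \<otimes>\<^bsub>S\<^esub> \<sigma> (b l)))"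
    unfolding sandwich_def using assms b_closed by (intro S.finsum_rdistr) (auto simp: Pi_iff)
  also have "\<dots> = sandwich S \<sigma> b n (\<lambda>l. e \<otimes> u l) z"
    unfolding sandwich_def using assms b_closed
    by (intro S.finsum_cong') (auto simp: Pi_iff S.m_assoc)
  finally show ?thesis .
qed

text \<open>Right multiplication spoils the right-hand factors: \<open>b l \<otimes> e\<close> has
  to be expanded in the basis again. Its coordinates \<open>c l i\<close> are central, so they pass
  \<open>b i\<close>, and by \<open>comm\<close> also \<open>z\<close>, and end up in the left
  coefficients.\<close>

lemma sandwich_rmult:
  assumes u: "u \<in> {..<n} \<rightarrow> carrier R" and z: "z \<in> carrier S" and e: "e \<in> carrier R"
    and comm: "\<And>a. a \<in> ring_center R \<Longrightarrow> \<sigma> a \<otimes>\<^bsub>S\<^esub> z = z \<otimes>\<^bsub>S\<^esub> \<sigma> a"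
    and c: "\<And>l. l < n \<Longrightarrow> c l \<in> {..<n} \<rightarrow> ring_center R"
    and be: "\<And>l. l < n \<Longrightarrow> b l \<otimes> e = (\<Oplus>i\<in>{..<n}. b i \<otimes> c l i)"
  shows "sandwich S \<sigma> b n u z \<otimes>\<^bsub>S\<^esub> \<sigma> e = sandwich S \<sigma> b n (\<lambda>i. \<Oplus>l\<in>{..<n}. u l \<otimes> c l i) z"
proof -
  have uc: "u l \<in> carrier R" if "l < n" for l using u that by auto
  have cz: "c l i \<in> ring_center R" if "l < n" "i < n" for l i using c[OF that(1)] that(2) by auto
  note cc = R.centerD(1)[OF cz]
  have "sandwich S \<sigma> b n u z \<otimes>\<^bsub>S\<^esub> \<sigma> e =
      (\<Oplus>\<^bsub>S\<^esub>l\<in>{..<n}. \<sigma> (u l) \<otimes>\<^bsub>S\<^esub> z \<otimes>\<^bsub>S\<^esub> \<sigma> (b l) \<otimes>\<^bsub>S\<^esub> \<sigma> e)"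
    unfolding sandwich_def using uc b_closed z e by (intro S.finsum_ldistr) auto
  also have "\<dots> = (\<Oplus>\<^bsub>S\<^esub>l\<in>{..<n}. \<Oplus>\<^bsub>S\<^esub>i\<in>{..<n}. \<sigma> (u l \<otimes> c l i) \<otimes>\<^bsub>S\<^esub> z \<otimes>\<^bsub>S\<^esub> \<sigma> (b i))"
  proof (rule S.finsum_cong')
    fix l assume "l \<in> {..<n}"
    then have l: "l < n" by simp
    have "\<sigma> (u l) \<otimes>\<^bsub>S\<^esub> z \<otimes>\<^bsub>S\<^esub> \<sigma> (b l) \<otimes>\<^bsub>S\<^esub> \<sigma> e = \<sigma> (u l) \<otimes>\<^bsub>S\<^esub> z \<otimes>\<^bsub>S\<^esub> \<sigma> (b l \<otimes> e)"
      using uc b_closed z e l by (simp add: S.m_assoc)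
    also have "\<dots> = \<sigma> (u l) \<otimes>\<^bsub>S\<^esub> z \<otimes>\<^bsub>S\<^esub> (\<Oplus>\<^bsub>S\<^esub>i\<in>{..<n}. \<sigma> (b i \<otimes> c l i))"
      using be[OF l] b_closed cc l by (subst hom_finsum[symmetric, unfolded comp_def]) auto
    also have "\<dots> = (\<Oplus>\<^bsub>S\<^esub>i\<in>{..<n}. \<sigma> (u l) \<otimes>\<^bsub>S\<^esub> z \<otimes>\<^bsub>S\<^esub> \<sigma> (b i \<otimes> c l i))"
      using uc b_closed z cc l by (intro S.finsum_rdistr) auto
    also have "\<dots> = (\<Oplus>\<^bsub>S\<^esub>i\<in>{..<n}. \<sigma> (u l \<otimes> c l i) \<otimes>\<^bsub>S\<^esub> z \<otimes>\<^bsub>S\<^esub> \<sigma> (b i))"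
    proof (rule S.finsum_cong')
      fix i assume "i \<in> {..<n}"
      then have i: "i < n" by simp
      have "\<sigma> (u l) \<otimes>\<^bsub>S\<^esub> z \<otimes>\<^bsub>S\<^esub> \<sigma> (b i \<otimes> c l i) = \<sigma> (u l) \<otimes>\<^bsub>S\<^esub> (z \<otimes>\<^bsub>S\<^esub> \<sigma> (c l i)) \<otimes>\<^bsub>S\<^esub> \<sigma> (b i)"
        using uc[OF l] b_closed[OF i] z cc[OF l i] R.centerD(2)[OF cz[OF l i] b_closed[OF i], symmetric]
        by (simp add: S.m_assoc)
      also have "\<dots> = \<sigma> (u l \<otimes> c l i) \<otimes>\<^bsub>S\<^esub> z \<otimes>\<^bsub>S\<^esub> \<sigma> (b i)"
        unfolding comm[OF cz[OF l i], symmetric]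
        using uc[OF l] b_closed[OF i] z cc[OF l i] by (simp add: S.m_assoc)
      finally show "\<sigma> (u l) \<otimes>\<^bsub>S\<^esub> z \<otimes>\<^bsub>S\<^esub> \<sigma> (b i \<otimes> c l i) =
        \<sigma> (u l \<otimes> c l i) \<otimes>\<^bsub>S\<^esub> z \<otimes>\<^bsub>S\<^esub> \<sigma> (b i)" .
    qed (use uc b_closed z cc l in auto)
    finally show "\<sigma> (u l) \<otimes>\<^bsub>S\<^esub> z \<otimes>\<^bsub>S\<^esub> \<sigma> (b l) \<otimes>\<^bsub>S\<^esub> \<sigma> e =
      (\<Oplus>\<^bsub>S\<^esub>i\<in>{..<n}. \<sigma> (u l \<otimes> c l i) \<otimes>\<^bsub>S\<^esub> z \<otimes>\<^bsub>S\<^esub> \<sigma> (b i))" .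
  qed (use uc b_closed z cc in \<open>auto intro!: S.finsum_closed\<close>)
  also have "\<dots> = (\<Oplus>\<^bsub>S\<^esub>i\<in>{..<n}. \<Oplus>\<^bsub>S\<^esub>l\<in>{..<n}. \<sigma> (u l \<otimes> c l i) \<otimes>\<^bsub>S\<^esub> z \<otimes>\<^bsub>S\<^esub> \<sigma> (b i))"
    using uc b_closed z cc by (intro S.finsum_swap) auto
  also have "\<dots> = sandwich S \<sigma> b n (\<lambda>i. \<Oplus>l\<in>{..<n}. u l \<otimes> c l i) z"
    unfolding sandwich_def
  proof (rule S.finsum_cong')
    fix i assume "i \<in> {..<n}"
    then have i: "i < n" by simp
    have "\<sigma> (\<Oplus>l\<in>{..<n}. u l \<otimes> c l i) = (\<Oplus>\<^bsub>S\<^esub>l\<in>{..<n}. \<sigma> (u l \<otimes> c l i))"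
      using uc cc i by (subst hom_finsum) (auto simp: comp_def)
    then show "(\<Oplus>\<^bsub>S\<^esub>l\<in>{..<n}. \<sigma> (u l \<otimes> c l i) \<otimes>\<^bsub>S\<^esub> z \<otimes>\<^bsub>S\<^esub> \<sigma> (b i)) =
        \<sigma> (\<Oplus>l\<in>{..<n}. u l \<otimes> c l i) \<otimes>\<^bsub>S\<^esub> z \<otimes>\<^bsub>S\<^esub> \<sigma> (b i)"
      using uc cc i b_closed[OF i] z
      by (subst S.finsum_ldistr[symmetric] | simp add: Pi_iff)+
  qed (use uc b_closed z cc in \<open>auto intro!: S.finsum_closed R.finsum_closed S.m_closed hom_closed\<close>)
  finally show ?thesis .
qed

lemma sandwich_sum:
  assumes U: "\<And>k. k < n \<Longrightarrow> U k \<in> {..<n} \<rightarrow> carrier R" and z: "z \<in> carrier S"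
  shows "(\<Oplus>\<^bsub>S\<^esub>k\<in>{..<n}. \<sigma> (b k) \<otimes>\<^bsub>S\<^esub> sandwich S \<sigma> b n (U k) z) =
    sandwich S \<sigma> b n (\<lambda>l. \<Oplus>k\<in>{..<n}. b k \<otimes> U k l) z"
proof -
  have Uc: "U k l \<in> carrier R" if "k < n" "l < n" for k l using U[OF that(1)] that(2) by auto
  have "(\<Oplus>\<^bsub>S\<^esub>k\<in>{..<n}. \<sigma> (b k) \<otimes>\<^bsub>S\<^esub> sandwich S \<sigma> b n (U k) z) =
      (\<Oplus>\<^bsub>S\<^esub>k\<in>{..<n}. \<Oplus>\<^bsub>S\<^esub>l\<in>{..<n}. \<sigma> (b k \<otimes> U k l) \<otimes>\<^bsub>S\<^esub> z \<otimes>\<^bsub>S\<^esub> \<sigma> (b l))"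
    using Uc b_closed z
    by (intro S.finsum_cong')
      (auto simp: sandwich_lmult[OF U z], auto simp: sandwich_def intro!: S.finsum_closed)
  also have "\<dots> = (\<Oplus>\<^bsub>S\<^esub>l\<in>{..<n}. \<Oplus>\<^bsub>S\<^esub>k\<in>{..<n}. \<sigma> (b k \<otimes> U k l) \<otimes>\<^bsub>S\<^esub> z \<otimes>\<^bsub>S\<^esub> \<sigma> (b l))"
    using Uc b_closed z by (intro S.finsum_swap) auto
  also have "\<dots> = sandwich S \<sigma> b n (\<lambda>l. \<Oplus>k\<in>{..<n}. b k \<otimes> U k l) z"
    unfolding sandwich_def
  proof (rule S.finsum_cong')
    fix l assume "l \<in> {..<n}"
    then have l: "l < n" by simp
    have "\<sigma> (\<Oplus>k\<in>{..<n}. b k \<otimes> U k l) = (\<Oplus>\<^bsub>S\<^esub>k\<in>{..<n}. \<sigma> (b k \<otimes> U k l))"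
      using Uc b_closed l by (subst hom_finsum) (auto simp: comp_def)
    then show "(\<Oplus>\<^bsub>S\<^esub>k\<in>{..<n}. \<sigma> (b k \<otimes> U k l) \<otimes>\<^bsub>S\<^esub> z \<otimes>\<^bsub>S\<^esub> \<sigma> (b l)) =
        \<sigma> (\<Oplus>k\<in>{..<n}. b k \<otimes> U k l) \<otimes>\<^bsub>S\<^esub> z \<otimes>\<^bsub>S\<^esub> \<sigma> (b l)"
      using Uc b_closed l z by (subst S.finsum_ldistr[symmetric] | simp add: Pi_iff)+
  qed (use Uc b_closed z in \<open>auto intro!: S.finsum_closed R.finsum_closed S.m_closed hom_closed\<close>)
  finally show ?thesis .
qed

end

text \<open>Since \<open>b 0\<close> is the unit, the tuple with a single \<open>\<one>\<close> at
  index 0 encodes the identity operator.\<close>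

lemma (in central_basis_hom) sandwich_unit:
  assumes z: "z \<in> carrier S"
  shows "sandwich S \<sigma> b n (\<lambda>l. if l = 0 then \<one> else \<zero>) z = z"
proof -
  have "sandwich S \<sigma> b n (\<lambda>l. if l = 0 then \<one> else \<zero>) z =
      (\<Oplus>\<^bsub>S\<^esub>l\<in>{..<n}. if 0 = l then z \<otimes>\<^bsub>S\<^esub> \<sigma> (b l) else \<zero>\<^bsub>S\<^esub>)"
    unfolding sandwich_def using z b_closed by (intro S.finsum_cong') auto
  also have "\<dots> = z \<otimes>\<^bsub>S\<^esub> \<sigma> (b 0)"
    using z b_closed n_pos by (intro S.finsum_singleton) auto
  finally show ?thesis using z by (simp add: b_0)
qed

section \<open>Dual systems and faithfulness of the coefficient tuples\<close>

context central_basis begin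

lemma central_basis_hom_id: "central_basis_hom R b n R id"
  by (intro central_basis_hom.intro central_basis_axioms ring_hom_ringI2 ring_axioms ring_hom_memI)
    simp_all

interpretation I: central_basis_hom R b n R id
  by (rule central_basis_hom_id)

lemma structure_constants:
  assumes "e \<in> carrier R"
  obtains c where "\<And>l. l < n \<Longrightarrow> c l \<in> {..<n} \<rightarrow> ring_center R"
    and "\<And>l. l < n \<Longrightarrow> b l \<otimes> e = (\<Oplus>i\<in>{..<n}. b i \<otimes> c l i)"
proof -
  have "\<forall>l. \<exists>c. l < n \<longrightarrow>
      c \<in> {..<n} \<rightarrow> ring_center R \<and> b l \<otimes> e = (\<Oplus>i\<in>{..<n}. b i \<otimes> c i)"
    using span[OF m_closed[OF b_closed assms]] by blast
  from choice[OF this] show thesis using that by blast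
qed

text \<open>Row \<open>k\<close> encodes the \<open>k\<close>-th coordinate functional. Prescribing
  it on the basis is enough, because sandwich operators on \<open>D\<close> are linear over the
  center; see \<open>dual_eval_coordinates\<close>.\<close>

definition dual_system :: "(nat \<Rightarrow> nat \<Rightarrow> 'a) \<Rightarrow> bool" where
  "dual_system U \<longleftrightarrow> (\<forall>k<n. U k \<in> {..<n} \<rightarrow> carrier R \<and>
     (\<forall>i<n. sandwich R id b n (U k) (b i) = (if i = k then \<one> else \<zero>)))"

lemma dual_system_exists: "\<exists>U. dual_system U"
proof -
  \<comment> \<open>Only values on the carrier count, so a function such as the identity qualifies
    although it may differ from its sandwich form elsewhere.\<close>
  let ?T = "{f. \<exists>u\<in>{..<n} \<rightarrow> carrier R. \<forall>x\<in>carrier R. f x = sandwich R id b n u x}"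
  have "\<forall>k\<in>{..<n}. \<exists>f\<in>?T. \<forall>i\<in>{..<n}. f (b i) = (if i = k then \<one> else \<zero>)"
  proof (rule density)
    show "f x \<in> carrier R" if "f \<in> ?T" "x \<in> carrier R" for f x
      using that I.sandwich_closed by auto
    show "(\<lambda>x. x) \<in> ?T"
      using I.sandwich_unit by (intro CollectI bexI[of _ "\<lambda>l. if l = 0 then \<one> else \<zero>"]) auto
    have "sandwich R id b n (\<lambda>l. \<zero>) x = \<zero>" if "x \<in> carrier R" for x
      unfolding sandwich_def
      by (subst finsum_cong'[where g = "\<lambda>l. \<zero>"]) (use b_closed that in auto)
    then show "(\<lambda>x. \<zero>) \<in> ?T"
      by (intro CollectI bexI[of _ "\<lambda>l. \<zero>"]) auto
    show "(\<lambda>x. f x \<oplus> g x) \<in> ?T" if f: "f \<in> ?T" and g: "g \<in> ?T" for f g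
    proof -
      obtain u v where "u \<in> {..<n} \<rightarrow> carrier R" "\<forall>x\<in>carrier R. f x = sandwich R id b n u x"
        "v \<in> {..<n} \<rightarrow> carrier R" "\<forall>x\<in>carrier R. g x = sandwich R id b n v x"
        using f g by blast
      then show ?thesis
        by (intro CollectI bexI[of _ "\<lambda>l. u l \<oplus> v l"]) (auto simp: I.sandwich_add Pi_iff)
    qed
    show "(\<lambda>x. e \<otimes> f x) \<in> ?T" if f: "f \<in> ?T" and e: "e \<in> carrier R" for f e
    proof -
      obtain u where u: "u \<in> {..<n} \<rightarrow> carrier R"
        "\<forall>x\<in>carrier R. f x = sandwich R id b n u x"
        using f by blast
      then show ?thesis
        using I.sandwich_lmult[OF u(1) _ e] e
        by (intro CollectI bexI[of _ "\<lambda>l. e \<otimes> u l"]) auto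
    qed
    show "(\<lambda>x. f x \<otimes> e) \<in> ?T" if f: "f \<in> ?T" and e: "e \<in> carrier R" for f e
    proof -
      obtain u where u: "u \<in> {..<n} \<rightarrow> carrier R"
        "\<forall>x\<in>carrier R. f x = sandwich R id b n u x"
        using f by blast
      obtain c where c: "\<And>l. l < n \<Longrightarrow> c l \<in> {..<n} \<rightarrow> ring_center R"
        "\<And>l. l < n \<Longrightarrow> b l \<otimes> e = (\<Oplus>i\<in>{..<n}. b i \<otimes> c l i)"
        using structure_constants[OF e] by blast
      let ?v = "\<lambda>i. \<Oplus>l\<in>{..<n}. u l \<otimes> c l i"
      have "?v \<in> {..<n} \<rightarrow> carrier R"
        using u(1) centerD(1)[OF funcset_mem[OF c(1)]]
        by (auto intro!: finsum_closed m_closed)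
      moreover have "f x \<otimes> e = sandwich R id b n ?v x" if "x \<in> carrier R" for x
        using I.sandwich_rmult[OF u(1) that e centerD(2)[OF _ that] c] u(2) that by simp
      ultimately show ?thesis by blast
    qed
    show "b \<in> {..<n} \<rightarrow> carrier R" using b_closed by auto
  qed (use indep in auto)
  then have T: "\<exists>f\<in>?T. \<forall>i\<in>{..<n}. f (b i) = (if i = k then \<one> else \<zero>)" if "k < n" for k
    using that by blast
  have "\<exists>u. u \<in> {..<n} \<rightarrow> carrier R \<and>
     (\<forall>i<n. sandwich R id b n u (b i) = (if i = k then \<one> else \<zero>))" if k: "k < n" for k
  proof -
    obtain f u where f: "\<forall>i\<in>{..<n}. f (b i) = (if i = k then \<one> else \<zero>)"
      and u: "u \<in> {..<n} \<rightarrow> carrier R" "\<forall>x\<in>carrier R. f x = sandwich R id b n u x"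
      using T[OF k] by blast
    have "sandwich R id b n u (b i) = (if i = k then \<one> else \<zero>)" if "i < n" for i
      using f u(2) b_closed[OF that] that by auto
    with u(1) show ?thesis by blast
  qed
  then have "\<forall>k. \<exists>u. k < n \<longrightarrow> u \<in> {..<n} \<rightarrow> carrier R \<and>
     (\<forall>i<n. sandwich R id b n u (b i) = (if i = k then \<one> else \<zero>))"
    by blast
  from choice[OF this] show ?thesis unfolding dual_system_def by blast
qed

text \<open>The coefficients of a sandwich operator are recovered by sandwiching its values
  between the dual system and the basis: \<open>u k = \<Oplus>l. f (U k l) \<otimes> b l\<close>.\<close>

lemma sandwich_inject:
  assumes U: "dual_system U"
    and u: "u \<in> {..<n} \<rightarrow> carrier R" and v: "v \<in> {..<n} \<rightarrow> carrier R"
    and eq: "\<And>x. x \<in> carrier R \<Longrightarrow> sandwich R id b n u x = sandwich R id b n v x"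
    and k: "k < n"
  shows "u k = v k"
proof -
  have Uc: "U k l \<in> carrier R" if "l < n" for l
    using U k that by (auto simp: dual_system_def Pi_iff)
  have coeff: "(\<Oplus>l\<in>{..<n}. sandwich R id b n w (U k l) \<otimes> b l) = w k"
    if w: "w \<in> {..<n} \<rightarrow> carrier R" for w
  proof -
    have wc: "w j \<in> carrier R" if "j < n" for j using w that by auto
    have "(\<Oplus>l\<in>{..<n}. sandwich R id b n w (U k l) \<otimes> b l) =
        (\<Oplus>l\<in>{..<n}. \<Oplus>j\<in>{..<n}. w j \<otimes> U k l \<otimes> b j \<otimes> b l)"
      unfolding sandwich_def using wc Uc b_closed
      by (intro finsum_cong') (auto simp: finsum_ldistr Pi_iff intro!: finsum_closed)
    also have "\<dots> = (\<Oplus>j\<in>{..<n}. \<Oplus>l\<in>{..<n}. w j \<otimes> U k l \<otimes> b j \<otimes> b l)"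
      using wc Uc b_closed by (intro finsum_swap) auto
    \<comment> \<open>The argument and the right-hand factor trade roles: the inner sum is the
      operator of \<open>U k\<close> at \<open>b j\<close>, and duality singles out
      \<open>w k\<close>.\<close>
    also have "\<dots> = (\<Oplus>j\<in>{..<n}. w j \<otimes> sandwich R id b n (U k) (b j))"
    proof (rule finsum_cong')
      fix j assume "j \<in> {..<n}"
      then have j: "j < n" by simp
      show "(\<Oplus>l\<in>{..<n}. w j \<otimes> U k l \<otimes> b j \<otimes> b l) = w j \<otimes> sandwich R id b n (U k) (b j)"
        unfolding sandwich_def using wc[OF j] Uc b_closed b_closed[OF j]
        by (subst finsum_rdistr) (auto simp: m_assoc intro!: finsum_cong')
    qed (use wc I.sandwich_closed[of "U k"] Uc b_closed in auto)
    also have "\<dots> = (\<Oplus>j\<in>{..<n}. if k = j then w j else \<zero>)"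
      using U k wc by (intro finsum_cong') (auto simp: dual_system_def)
    also have "\<dots> = w k" using k wc by (intro finsum_singleton) auto
    finally show ?thesis .
  qed
  have "(\<Oplus>l\<in>{..<n}. sandwich R id b n u (U k l) \<otimes> b l) =
      (\<Oplus>l\<in>{..<n}. sandwich R id b n v (U k l) \<otimes> b l)"
    using eq Uc b_closed I.sandwich_closed[OF v] by (intro finsum_cong') auto
  then show ?thesis using coeff[OF u] coeff[OF v] by simp
qed

end

section \<open>Transfer from \<open>D\<close> to a ring over \<open>D\<close>\<close>

context central_basis_hom begin

interpretation I: central_basis_hom R b n R id
  by (rule central_basis_hom_id)

text \<open>The \<open>w i\<close> commute with the basis, so they leave the sandwich on the right,
  and what remains is the operator of \<open>U k\<close> at \<open>b i\<close>, computed in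
  \<open>D\<close>. Central \<open>w\<close> give coordinates in \<open>D\<close>; with variables
  for \<open>w\<close>, each variable is recovered from the image of \<open>z\<close>.\<close>

lemma dual_eval:
  assumes U: "dual_system U" and k: "k < n"
    and w: "\<And>i. i < n \<Longrightarrow> w i \<in> carrier S"
    and comm: "\<And>i l. \<lbrakk>i < n; l < n\<rbrakk> \<Longrightarrow> w i \<otimes>\<^bsub>S\<^esub> \<sigma> (b l) = \<sigma> (b l) \<otimes>\<^bsub>S\<^esub> w i"
  shows "sandwich S \<sigma> b n (U k) (\<Oplus>\<^bsub>S\<^esub>i\<in>{..<n}. \<sigma> (b i) \<otimes>\<^bsub>S\<^esub> w i) = w k"
proof -
  have Uc: "U k l \<in> carrier R" if "l < n" for l
    using U k that by (auto simp: dual_system_def Pi_iff)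
  have "sandwich S \<sigma> b n (U k) (\<Oplus>\<^bsub>S\<^esub>i\<in>{..<n}. \<sigma> (b i) \<otimes>\<^bsub>S\<^esub> w i) =
      (\<Oplus>\<^bsub>S\<^esub>l\<in>{..<n}. \<Oplus>\<^bsub>S\<^esub>i\<in>{..<n}. \<sigma> (U k l \<otimes> b i \<otimes> b l) \<otimes>\<^bsub>S\<^esub> w i)"
    unfolding sandwich_def
  proof (rule S.finsum_cong')
    fix l assume "l \<in> {..<n}"
    then have l: "l < n" by simp
    have "\<sigma> (U k l) \<otimes>\<^bsub>S\<^esub> (\<Oplus>\<^bsub>S\<^esub>i\<in>{..<n}. \<sigma> (b i) \<otimes>\<^bsub>S\<^esub> w i) \<otimes>\<^bsub>S\<^esub> \<sigma> (b l) =
        (\<Oplus>\<^bsub>S\<^esub>i\<in>{..<n}. \<sigma> (U k l) \<otimes>\<^bsub>S\<^esub> (\<sigma> (b i) \<otimes>\<^bsub>S\<^esub> w i) \<otimes>\<^bsub>S\<^esub> \<sigma> (b l))"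
      using Uc[OF l] b_closed b_closed[OF l] w
      by (simp add: S.finsum_rdistr S.finsum_ldistr Pi_iff)
    also have "\<dots> = (\<Oplus>\<^bsub>S\<^esub>i\<in>{..<n}. \<sigma> (U k l \<otimes> b i \<otimes> b l) \<otimes>\<^bsub>S\<^esub> w i)"
      using Uc[OF l] b_closed b_closed[OF l] w
      by (intro S.finsum_cong') (auto simp: S.m_assoc comm[OF _ l])
    finally show "\<sigma> (U k l) \<otimes>\<^bsub>S\<^esub> (\<Oplus>\<^bsub>S\<^esub>i\<in>{..<n}. \<sigma> (b i) \<otimes>\<^bsub>S\<^esub> w i) \<otimes>\<^bsub>S\<^esub> \<sigma> (b l) =
        (\<Oplus>\<^bsub>S\<^esub>i\<in>{..<n}. \<sigma> (U k l \<otimes> b i \<otimes> b l) \<otimes>\<^bsub>S\<^esub> w i)" .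
  qed (use Uc b_closed w in \<open>auto intro!: S.finsum_closed\<close>)
  also have "\<dots> = (\<Oplus>\<^bsub>S\<^esub>i\<in>{..<n}. \<Oplus>\<^bsub>S\<^esub>l\<in>{..<n}. \<sigma> (U k l \<otimes> b i \<otimes> b l) \<otimes>\<^bsub>S\<^esub> w i)"
    using Uc b_closed w by (intro S.finsum_swap) auto
  also have "\<dots> = (\<Oplus>\<^bsub>S\<^esub>i\<in>{..<n}. if k = i then w i else \<zero>\<^bsub>S\<^esub>)"
  proof (rule S.finsum_cong')
    fix i assume "i \<in> {..<n}"
    then have i: "i < n" by simp
    have "(\<Oplus>\<^bsub>S\<^esub>l\<in>{..<n}. \<sigma> (U k l \<otimes> b i \<otimes> b l) \<otimes>\<^bsub>S\<^esub> w i) =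
        (\<Oplus>\<^bsub>S\<^esub>l\<in>{..<n}. \<sigma> (U k l \<otimes> b i \<otimes> b l)) \<otimes>\<^bsub>S\<^esub> w i"
      using Uc b_closed b_closed[OF i] w[OF i] by (intro S.finsum_ldistr[symmetric]) auto
    also have "(\<Oplus>\<^bsub>S\<^esub>l\<in>{..<n}. \<sigma> (U k l \<otimes> b i \<otimes> b l)) = \<sigma> (sandwich R id b n (U k) (b i))"
      unfolding sandwich_def using Uc b_closed b_closed[OF i]
      by (subst hom_finsum) (auto simp: comp_def)
    finally show "(\<Oplus>\<^bsub>S\<^esub>l\<in>{..<n}. \<sigma> (U k l \<otimes> b i \<otimes> b l) \<otimes>\<^bsub>S\<^esub> w i) = (if k = i then w i else \<zero>\<^bsub>S\<^esub>)"
      using U k i w[OF i] by (auto simp: dual_system_def)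
  qed (use w in auto)
  also have "\<dots> = w k" using k w by (intro S.finsum_singleton) auto
  finally show ?thesis .
qed

end

lemma (in central_basis) dual_eval_coordinates:
  assumes "dual_system U" "k < n" and c: "c \<in> {..<n} \<rightarrow> ring_center R"
  shows "sandwich R id b n (U k) (\<Oplus>i\<in>{..<n}. b i \<otimes> c i) = c k"
  using central_basis_hom.dual_eval[OF central_basis_hom_id assms(1,2), of c] centerD b_closed c
  by (auto simp: Pi_iff)

context central_basis_hom begin

interpretation I: central_basis_hom R b n R id
  by (rule central_basis_hom_id)

text \<open>Both sides are sandwiches of \<open>z\<close>, with tuples \<open>?w\<close> and
  \<open>?v\<close>. On \<open>D\<close> their operators agree, because the \<open>k\<close>-th
  coordinate of \<open>x\<close> is central and so commutes with \<open>e\<close>. By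
  \<open>sandwich_inject\<close> the tuples agree, hence so do the elements of
  \<open>S\<close>.\<close>

lemma dual_commute:
  assumes U: "dual_system U" and k: "k < n" and z: "z \<in> carrier S" and e: "e \<in> carrier R"
    and comm: "\<And>a. a \<in> ring_center R \<Longrightarrow> \<sigma> a \<otimes>\<^bsub>S\<^esub> z = z \<otimes>\<^bsub>S\<^esub> \<sigma> a"
  shows "\<sigma> e \<otimes>\<^bsub>S\<^esub> sandwich S \<sigma> b n (U k) z = sandwich S \<sigma> b n (U k) z \<otimes>\<^bsub>S\<^esub> \<sigma> e"
proof -
  have Uk: "U k \<in> {..<n} \<rightarrow> carrier R"
    using U k by (auto simp: dual_system_def)
  obtain c where c: "\<And>l. l < n \<Longrightarrow> c l \<in> {..<n} \<rightarrow> ring_center R"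
    "\<And>l. l < n \<Longrightarrow> b l \<otimes> e = (\<Oplus>i\<in>{..<n}. b i \<otimes> c l i)"
    using structure_constants[OF e] by blast
  let ?v = "\<lambda>i. \<Oplus>l\<in>{..<n}. U k l \<otimes> c l i" and ?w = "\<lambda>i. e \<otimes> U k i"
  have v: "?v \<in> {..<n} \<rightarrow> carrier R"
    using Uk R.centerD(1)[OF funcset_mem[OF c(1)]] by (auto intro!: R.finsum_closed R.m_closed)
  have w: "?w \<in> {..<n} \<rightarrow> carrier R" using Uk e by auto
  have "sandwich R id b n ?w x = sandwich R id b n ?v x" if x: "x \<in> carrier R" for x
  proof -
    obtain d where d: "d \<in> {..<n} \<rightarrow> ring_center R" "x = (\<Oplus>i\<in>{..<n}. b i \<otimes> d i)"
      using span[OF x] by blast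
    then have "sandwich R id b n (U k) x \<in> ring_center R"
      using dual_eval_coordinates[OF U k d(1)] k by auto
    then show ?thesis
      using I.sandwich_rmult[OF Uk x e R.centerD(2)[OF _ x] c] I.sandwich_lmult[OF Uk x e]
        R.centerD(2)[OF _ e] by simp
  qed
  then have "?w l = ?v l" if "l < n" for l
    using sandwich_inject[OF U w v _ that] by blast
  then show ?thesis
    using sandwich_rmult[OF Uk z e comm c] sandwich_lmult[OF Uk z e] sandwich_cong[OF w z, of ?v]
    by simp
qed

text \<open>The left side is the sandwich with tuple \<open>?v\<close>, whose operator rebuilds each
  \<open>x\<close> in \<open>D\<close> from its coordinates. That is the identity operator, so
  \<open>?v\<close> agrees with the tuple of \<open>sandwich_unit\<close>.\<close>

lemma dual_sum:
  assumes U: "dual_system U" and z: "z \<in> carrier S"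
  shows "(\<Oplus>\<^bsub>S\<^esub>k\<in>{..<n}. \<sigma> (b k) \<otimes>\<^bsub>S\<^esub> sandwich S \<sigma> b n (U k) z) = z"
proof -
  have Uk: "U k \<in> {..<n} \<rightarrow> carrier R" if "k < n" for k
    using U that by (auto simp: dual_system_def)
  let ?v = "\<lambda>l. \<Oplus>k\<in>{..<n}. b k \<otimes> U k l" and ?w = "\<lambda>l. if l = 0 then \<one> else \<zero>"
  have v: "?v \<in> {..<n} \<rightarrow> carrier R"
    using funcset_mem[OF Uk] b_closed by (auto intro!: R.finsum_closed R.m_closed)
  have w: "?w \<in> {..<n} \<rightarrow> carrier R" by auto
  have "sandwich R id b n ?v x = sandwich R id b n ?w x" if x: "x \<in> carrier R" for x
  proof -
    obtain d where d: "d \<in> {..<n} \<rightarrow> ring_center R" "x = (\<Oplus>i\<in>{..<n}. b i \<otimes> d i)"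
      using span[OF x] by blast
    have "sandwich R id b n ?v x = (\<Oplus>k\<in>{..<n}. b k \<otimes> sandwich R id b n (U k) x)"
      using I.sandwich_sum[OF Uk x] by simp
    also have "\<dots> = (\<Oplus>k\<in>{..<n}. b k \<otimes> d k)"
      using dual_eval_coordinates[OF U _ d(1)] d b_closed R.centerD(1)
      by (intro R.finsum_cong') (auto simp: Pi_iff)
    finally show ?thesis using I.sandwich_unit[OF x] d(2) by simp
  qed
  then have "?v l = ?w l" if "l < n" for l
    using sandwich_inject[OF U v w _ that] by blast
  then show ?thesis
    using sandwich_sum[OF Uk z] sandwich_cong[OF v z, of ?w] sandwich_unit[OF z] by simp
qed

lemma hom_sandwich:
  assumes T: "ring T" and h: "h \<in> ring_hom S T"
    and u: "u \<in> {..<n} \<rightarrow> carrier R" and z: "z \<in> carrier S"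
  shows "h (sandwich S \<sigma> b n u z) = sandwich T (\<lambda>x. h (\<sigma> x)) b n u (h z)"
proof -
  interpret h: ring_hom_ring S T h
    by (rule ring_hom_ringI2[OF S.ring_axioms T h])
  show ?thesis
    unfolding sandwich_def using u z b_closed
    by (subst h.hom_finsum) (auto simp: comp_def Pi_iff intro!: h.S.finsum_cong')
qed

end

section \<open>Spanning families with as many members as the dimension\<close>

lemma (in ring) finsum_in_Span:
  assumes K: "subfield K R" and Ws: "set Ws \<subseteq> carrier R"
    and "finite I" and "\<And>i. i \<in> I \<Longrightarrow> f i \<in> Span K Ws"
  shows "(\<Oplus>i\<in>I. f i) \<in> Span K Ws"
  using assms(3,4)
proof (induction I)
  case empty
  show ?case unfolding finsum_empty by (rule Span_subgroup_props(2)[OF K Ws])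
next
  case (insert j I)
  have closed: "f i \<in> carrier R" if "i \<in> insert j I" for i
    using insert.prems[OF that] Span_subgroup_props(1)[OF K Ws] by blast
  have "(\<Oplus>i\<in>insert j I. f i) = f j \<oplus> (\<Oplus>i\<in>I. f i)"
    using insert.hyps closed by (intro finsum_insert) auto
  moreover have "(\<Oplus>i\<in>I. f i) \<in> Span K Ws"
    by (rule insert.IH, rule insert.prems) simp
  ultimately show ?case
    using Span_subgroup_props(3)[OF K Ws insert.prems[of j]] by (metis insertI1)
qed

text \<open>A dependency would place some \<open>b k\<close>, and with it the whole carrier, in the
  span of the other \<open>N - 1\<close> members, contrary to
  \<open>dimension_le_length\<close>.\<close>

lemma (in skew_field) central_basisI:
  assumes dim: "dimension N (ring_center R) (carrier R)"
    and b: "\<And>i. i < N \<Longrightarrow> b i \<in> carrier R" and b_0: "b 0 = \<one>"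
    and span: "\<And>x. x \<in> carrier R \<Longrightarrow>
      \<exists>c\<in>{..<N} \<rightarrow> ring_center R. x = (\<Oplus>i\<in>{..<N}. b i \<otimes> c i)"
  shows "central_basis R b N"
proof (unfold_locales)
  note K = center_subfield
  show "0 < N"
    using dimension_zero[OF K, of "carrier R"] dim one_closed one_not_zero by (cases N) auto
  show "b k \<noteq> (\<Oplus>i\<in>I. b i \<otimes> c i)"
    if k: "k < N" and I: "I \<subseteq> {..<N} - {k}" and c: "c \<in> I \<rightarrow> ring_center R" for k I c
  proof
    assume bk: "b k = (\<Oplus>i\<in>I. b i \<otimes> c i)"
    have "finite ({..<N} - {k})" by simp
    then obtain ks where ks: "set ks = {..<N} - {k}" "distinct ks"
      using finite_distinct_list by blast
    have len: "length (map b ks) = N - 1"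
      using ks k distinct_card[of ks] by simp
    have Ws: "set (map b ks) \<subseteq> carrier R" using ks b by auto
    \<comment> \<open>\<open>Span\<close> has its scalars on the left, the expansions here have them
      on the right; for central scalars this is the same.\<close>
    have smult: "x \<otimes> d \<in> Span (ring_center R) (map b ks)"
      if "x \<in> Span (ring_center R) (map b ks)" "d \<in> ring_center R" for x d
      using Span_smult_closed[OF K Ws that(2,1)] centerD(2)[OF that(2), of x]
        Span_subgroup_props(1)[OF K Ws] that(1) by auto
    have mem: "b i \<in> Span (ring_center R) (map b ks)" if "i \<in> {..<N} - {k}" for i
    proof -
      have "b i \<in> set (map b ks)" using that ks by simp
      then show ?thesis using Span_base_incl[OF K Ws] by blast
    qed
    have "b k \<in> Span (ring_center R) (map b ks)"
      unfolding bk
    proof (rule finsum_in_Span[OF K Ws])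
      show "finite I" using I finite_subset by blast
      show "b i \<otimes> c i \<in> Span (ring_center R) (map b ks)" if "i \<in> I" for i
        using that I c by (intro smult mem) auto
    qed
    with mem have mem': "b i \<in> Span (ring_center R) (map b ks)" if "i < N" for i
      using that by (cases "i = k") (blast, blast)
    have "carrier R \<subseteq> Span (ring_center R) (map b ks)"
    proof
      fix x assume "x \<in> carrier R"
      then obtain d where d: "d \<in> {..<N} \<rightarrow> ring_center R" "x = (\<Oplus>i\<in>{..<N}. b i \<otimes> d i)"
        using span by blast
      show "x \<in> Span (ring_center R) (map b ks)"
        unfolding d(2)
      proof (rule finsum_in_Span[OF K Ws finite_lessThan])
        show "b i \<otimes> d i \<in> Span (ring_center R) (map b ks)" if "i \<in> {..<N}" for i
          using that d(1) by (intro smult mem') auto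
      qed
    qed
    from dimension_le_length[OF K dim Ws this] len k show False by simp
  qed
qed (use b b_0 span in auto)

section \<open>The substitution homomorphism is an isomorphism\<close>

theorem theorem2p1:
  fixes D :: "('a, 'm) ring_scheme" and p N :: nat and a :: "nat \<Rightarrow> 'a" and F :: "'a set"
  assumes D: "skew_field D"
    and F: "F = ring_center D"
    and N: "N = p ^ 2"
    and dim: "ring.dimension D N F (carrier D)"
    and a_Units: "\<And>i. i \<in> {1..N - 1} \<Longrightarrow> a i \<in> Units D"
    and a_span: "carrier D =
      {c 0 \<oplus>\<^bsub>D\<^esub> (\<Oplus>\<^bsub>D\<^esub>i\<in>{1..N - 1}. a i \<otimes>\<^bsub>D\<^esub> c i) | c. c \<in> {0..N - 1} \<rightarrow> F}"
  shows "(\<exists>h. is_substitution D N a h \<and>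
             (\<forall>h'. is_substitution D N a h' \<longrightarrow> (\<forall>u \<in> carrier (general_poly D). h' u = h u)) \<and>
             h \<in> ring_iso (general_poly D) (nc_poly D N)) \<and>
         general_poly D \<simeq> nc_poly D N"
proof -
  define V where "V = {1..N}"
  let ?G = "general_poly D" and ?A = "free_algebra D V"
  interpret D: skew_field D by fact
  note ringD = D.ring_axioms
  have ringG: "ring ?G" by (rule general_poly_is_ring[OF ringD])
  have ringA: "ring ?A" by (rule D.free_algebra_is_ring)
  interpret A: ring ?A by (rule ringA)
  define b where "b i = (if i = 0 then \<one>\<^bsub>D\<^esub> else a i)" for i
  \<comment> \<open>Positivity matters for the truncated \<open>N - 1\<close>: with
    \<open>N = 0\<close> the index 0 would still occur in \<open>a_span\<close> but not in
    \<open>{..<N}\<close>. Dimension 0 would force \<one> = \<zero>.\<close>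
  have N0: "0 < N"
    using D.dimension_zero[OF D.center_subfield, of "carrier D"] dim D.one_closed D.one_not_zero
    by (cases N) (auto simp: F)
  have ivl: "{..<N} = insert 0 {1..N - 1}" using N0 by auto
  have b_closed: "b i \<in> carrier D" if "i < N" for i
    using that a_Units[of i] D.Units_closed by (auto simp: b_def)
  have b0: "b 0 = \<one>\<^bsub>D\<^esub>" by (simp add: b_def)
  interpret B: central_basis D b N
  proof (rule D.central_basisI)
    fix x assume "x \<in> carrier D"
    then obtain c where c: "c \<in> {0..N - 1} \<rightarrow> F"
      and x: "x = c 0 \<oplus>\<^bsub>D\<^esub> (\<Oplus>\<^bsub>D\<^esub>i\<in>{1..N - 1}. a i \<otimes>\<^bsub>D\<^esub> c i)"
      using a_span by blast
    have c': "c \<in> {..<N} \<rightarrow> ring_center D" using c N0 by (auto simp: F Pi_iff)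
    have cD: "c i \<in> carrier D" if "i < N" for i
      using D.centerD(1)[OF funcset_mem[OF c']] that by simp
    have "(\<Oplus>\<^bsub>D\<^esub>i\<in>{1..N - 1}. a i \<otimes>\<^bsub>D\<^esub> c i) = (\<Oplus>\<^bsub>D\<^esub>i\<in>{1..N - 1}. b i \<otimes>\<^bsub>D\<^esub> c i)"
    proof (rule D.finsum_cong')
      show "(\<lambda>i. b i \<otimes>\<^bsub>D\<^esub> c i) \<in> {1..N - 1} \<rightarrow> carrier D"
        using b_closed cD N0 by auto
    qed (auto simp: b_def)
    then have "x = (\<Oplus>\<^bsub>D\<^esub>i\<in>{..<N}. b i \<otimes>\<^bsub>D\<^esub> c i)"
      unfolding x ivl using b_closed cD N0 by (subst D.finsum_insert) (auto simp: b0)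
    with c' show "\<exists>c\<in>{..<N} \<rightarrow> ring_center D. x = (\<Oplus>\<^bsub>D\<^esub>i\<in>{..<N}. b i \<otimes>\<^bsub>D\<^esub> c i)" by blast
  qed (use dim b_closed in \<open>auto simp: F b_def\<close>)
  obtain U where U: "B.dual_system U" using B.dual_system_exists by blast
  then have Uk: "U k \<in> {..<N} \<rightarrow> carrier D" if "k < N" for k
    using that by (simp add: B.dual_system_def)
  interpret cG: central_basis_hom D b N ?G "gp_const D"
    by (intro central_basis_hom.intro B.central_basis_axioms ring_hom_ringI2 ringD ringG
        gp_const_hom)
  interpret cA: central_basis_hom D b N ?A "fa_const D"
    by (intro central_basis_hom.intro B.central_basis_axioms ring_hom_ringI2 ringD ringA
        D.fa_const_hom)
  \<comment> \<open>Variables are numbered from 1 and the basis from 0, hence the shift by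
    \<open>Suc\<close>; \<open>w\<close> below shifts back.\<close>
  define X :: "nat \<Rightarrow> nat list \<Rightarrow> 'a" where "X i = fa_var D (Suc i)" for i
  have X: "X i \<in> carrier ?A" if "i < N" for i
    unfolding X_def using that by (intro D.fa_var_closed) (auto simp: V_def)
  have X_comm: "fa_const D r \<otimes>\<^bsub>?A\<^esub> X i = X i \<otimes>\<^bsub>?A\<^esub> fa_const D r"
    if "r \<in> carrier D" "i < N" for r i
    unfolding X_def using that by (intro D.fa_const_var_commute) (auto simp: V_def)
  define s where "s = (\<Oplus>\<^bsub>?A\<^esub>i\<in>{..<N}. fa_const D (b i) \<otimes>\<^bsub>?A\<^esub> X i)"
  have s: "s \<in> carrier ?A"
    unfolding s_def using X b_closed by (intro A.finsum_closed) auto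
  \<comment> \<open>This is the condition for sending \<open>z\<close> to \<open>s\<close>: central
    constants commute with each \<open>b i\<close>, and variables with all constants.\<close>
  have s_comm: "fa_const D c \<otimes>\<^bsub>?A\<^esub> s = s \<otimes>\<^bsub>?A\<^esub> fa_const D c" if c: "c \<in> ring_center D" for c
  proof -
    note cD = D.centerD[OF c]
    have "fa_const D c \<otimes>\<^bsub>?A\<^esub> s =
        (\<Oplus>\<^bsub>?A\<^esub>i\<in>{..<N}. fa_const D c \<otimes>\<^bsub>?A\<^esub> (fa_const D (b i) \<otimes>\<^bsub>?A\<^esub> X i))"
      unfolding s_def using X b_closed cD(1) by (intro A.finsum_rdistr) auto
    also have "\<dots> = (\<Oplus>\<^bsub>?A\<^esub>i\<in>{..<N}. fa_const D (b i) \<otimes>\<^bsub>?A\<^esub> X i \<otimes>\<^bsub>?A\<^esub> fa_const D c)"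
    proof (rule A.finsum_cong')
      fix i assume "i \<in> {..<N}"
      then have i: "i < N" by simp
      have "fa_const D c \<otimes>\<^bsub>?A\<^esub> fa_const D (b i) = fa_const D (b i) \<otimes>\<^bsub>?A\<^esub> fa_const D c"
        using cA.hom_mult[OF cD(1) b_closed[OF i]] cA.hom_mult[OF b_closed[OF i] cD(1)]
          cD(2)[OF b_closed[OF i]] by simp
      then show "fa_const D c \<otimes>\<^bsub>?A\<^esub> (fa_const D (b i) \<otimes>\<^bsub>?A\<^esub> X i) =
          fa_const D (b i) \<otimes>\<^bsub>?A\<^esub> X i \<otimes>\<^bsub>?A\<^esub> fa_const D c"
        using A.m_assoc[OF cA.hom_closed[OF cD(1)] cA.hom_closed[OF b_closed[OF i]] X[OF i]]
          A.m_assoc[OF cA.hom_closed[OF b_closed[OF i]] cA.hom_closed[OF cD(1)] X[OF i]]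
          A.m_assoc[OF cA.hom_closed[OF b_closed[OF i]] X[OF i] cA.hom_closed[OF cD(1)]]
          X_comm[OF cD(1) i] by simp
    qed (use X b_closed cD(1) in auto)
    also have "\<dots> = s \<otimes>\<^bsub>?A\<^esub> fa_const D c"
      unfolding s_def using X b_closed cD(1) by (intro A.finsum_ldistr[symmetric]) auto
    finally show ?thesis .
  qed
  have s_eq: "fa_var D 1 \<oplus>\<^bsub>?A\<^esub>
      (\<Oplus>\<^bsub>?A\<^esub>i\<in>{1..N - 1}. fa_const D (a i) \<otimes>\<^bsub>?A\<^esub> fa_var D (i + 1)) = s"
  proof -
    have t: "fa_const D (b i) \<otimes>\<^bsub>?A\<^esub> X i \<in> carrier ?A" if "i < N" for i
      using that X b_closed by auto
    have "(\<Oplus>\<^bsub>?A\<^esub>i\<in>{1..N - 1}. fa_const D (a i) \<otimes>\<^bsub>?A\<^esub> fa_var D (i + 1)) =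
        (\<Oplus>\<^bsub>?A\<^esub>i\<in>{1..N - 1}. fa_const D (b i) \<otimes>\<^bsub>?A\<^esub> X i)"
    proof (rule A.finsum_cong')
      show "(\<lambda>i. fa_const D (b i) \<otimes>\<^bsub>?A\<^esub> X i) \<in> {1..N - 1} \<rightarrow> carrier ?A"
        using t N0 by auto
    qed (auto simp: b_def X_def)
    moreover have "fa_const D (b 0) \<otimes>\<^bsub>?A\<^esub> X 0 = fa_var D 1"
      using A.l_one[OF X[OF N0]] cA.hom_one by (simp add: b0 X_def)
    ultimately show ?thesis
      unfolding s_def ivl using t t[OF N0] N0 by (subst A.finsum_insert) auto
  qed
  obtain h where h: "h \<in> ring_hom ?G ?A" "\<And>d. d \<in> carrier D \<Longrightarrow> h (gp_const D d) = fa_const D d"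
    "h (gp_z D) = s"
    using general_poly_hom_exists[OF ringD ringA D.fa_const_hom s s_comm] by blast
  have z: "gp_z D \<in> carrier ?G" by (rule gp_z_closed[OF ringD])
  define y where "y k = sandwich ?G (gp_const D) b N (U k) (gp_z D)" for k
  have y: "y k \<in> carrier ?G" if "k < N" for k
    unfolding y_def by (rule cG.sandwich_closed[OF Uk[OF that] z])
  \<comment> \<open>The homomorphism \<open>h\<close> turns the sandwich of \<open>gp_z D\<close>
    into that of \<open>s\<close>, from which \<open>dual_eval\<close> extracts one
    variable.\<close>
  have hy: "h (y k) = X k" if k: "k < N" for k
  proof -
    have "h (y k) = sandwich ?A (\<lambda>x. h (gp_const D x)) b N (U k) s"
      unfolding y_def using cG.hom_sandwich[OF ringA h(1) Uk[OF k] z] h(3) by simp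
    also have "\<dots> = sandwich ?A (fa_const D) b N (U k) s"
      unfolding sandwich_def using h(2) Uk[OF k] b_closed s
      by (intro A.finsum_cong') (auto simp: Pi_iff)
    also have "\<dots> = X k"
      unfolding s_def using X X_comm b_closed by (intro cA.dual_eval[OF U k]) auto
    finally show ?thesis .
  qed
  define w where "w i = y (i - 1)" for i
  interpret E: free_algebra_eval D ?G "gp_const D" V w
  proof unfold_locales
    show "w i \<in> carrier ?G" if "i \<in> V" for i
      unfolding w_def using that by (intro y) (auto simp: V_def)
    \<comment> \<open>Here the defining relation that \<open>z\<close> commutes with the center
      enters, through \<open>gp_z_center\<close>.\<close>
    show "gp_const D r \<otimes>\<^bsub>?G\<^esub> w i = w i \<otimes>\<^bsub>?G\<^esub> gp_const D r"
      if "r \<in> carrier D" "i \<in> V" for r i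
      unfolding w_def y_def using that
      by (intro cG.dual_commute[OF U _ z _ gp_z_center[OF ringD]]) (auto simp: V_def)
  qed
  let ?g = E.eval_at
  note g = E.eval_hom
  interpret g: ring_hom_ring ?A ?G ?g
    by (rule ring_hom_ringI2[OF ringA ringG g])
  have gX: "?g (X i) = y i" if "i < N" for i
    using E.eval_var[of "Suc i"] that by (simp add: X_def V_def w_def)
  \<comment> \<open>The sum obtained here is the expansion that \<open>dual_sum\<close> identifies
    with \<open>gp_z D\<close>.\<close>
  have "?g s = (\<Oplus>\<^bsub>?G\<^esub>i\<in>{..<N}. gp_const D (b i) \<otimes>\<^bsub>?G\<^esub> y i)"
  proof -
    have "?g s = (\<Oplus>\<^bsub>?G\<^esub>i\<in>{..<N}. ?g (fa_const D (b i) \<otimes>\<^bsub>?A\<^esub> X i))"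
      unfolding s_def using X b_closed by (subst g.hom_finsum) (auto simp: comp_def)
    also have "\<dots> = (\<Oplus>\<^bsub>?G\<^esub>i\<in>{..<N}. gp_const D (b i) \<otimes>\<^bsub>?G\<^esub> y i)"
      using X y b_closed by (intro cG.S.finsum_cong') (auto simp: gX E.eval_const)
    finally show ?thesis .
  qed
  then have gs: "?g s = gp_z D"
    using cG.dual_sum[OF U z] by (simp add: y_def)
  \<comment> \<open>Both composites fix the generators, so the uniqueness of homomorphisms out of
    each ring makes them the identity.\<close>
  have gh: "?g (h u) = u" if u: "u \<in> carrier ?G" for u
  proof -
    have "(?g \<circ> h) u = id u"
      by (rule general_poly_hom_unique[OF ringD ringG ring_hom_trans[OF h(1) g] id_ring_hom _ _ u])
        (simp_all add: h E.eval_const gs)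
    then show ?thesis by simp
  qed
  have hg: "h (?g f) = f" if f: "f \<in> carrier ?A" for f
  proof -
    have "(h \<circ> ?g) f = id f"
    proof (rule free_algebra_hom_unique[OF ringD ringA ring_hom_trans[OF g h(1)] id_ring_hom _ _ f])
      show "(h \<circ> ?g) (fa_var D i) = id (fa_var D i)" if "i \<in> V" for i
        using E.eval_var[OF that] hy[of "i - 1"] that by (auto simp: X_def V_def w_def)
    qed (simp_all add: h E.eval_const)
    then show ?thesis by simp
  qed
  have sub: "is_substitution D N a h'
      \<longleftrightarrow> h' \<in> ring_hom ?G ?A \<and> (\<forall>d\<in>carrier D. h' (gp_const D d) = fa_const D d) \<and> h' (gp_z D) = s"
    for h'
    unfolding is_substitution_def V_def[symmetric] s_eq ..
  have "bij_betw h (carrier ?G) (carrier ?A)"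
    by (rule bij_betw_byWitness[where f' = ?g])
      (use gh hg ring_hom_closed[OF h(1)] E.eval_closed in auto)
  with h(1) have iso: "h \<in> ring_iso ?G ?A" by (simp add: ring_iso_def)
  have "h' u = h u" if h': "is_substitution D N a h'" and u: "u \<in> carrier ?G" for h' u
    using h' h unfolding sub
    by (intro general_poly_hom_unique[OF ringD ringA _ h(1) _ _ u]) auto
  moreover have "is_substitution D N a h" using h by (simp add: sub)
  ultimately show ?thesis using iso unfolding is_ring_iso_def V_def by blast
qed

end
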